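(* Let $R$ be a nonzero unital commutative ring which is indecomposable. Let $S$ be a non-empty set with a distinguished element $1\in S$, and let $A_S$ be the universal $R$-algebra generated by $S$ subject to the relations $x^2=x$ and $xy=yx$ for all $x,y\in S$, and that $1$ is a unit (multiplicative identity). Then $A_S$ is not the zero algebra, and the unital $R$-algebra homomorphism $\Psi:A_S\to\operatorname{Lc}(\widehat{E(A_S)},R)$ given by $\Psi(x)=1_{O_x}$ for all $x\in S$ is an isomorphism.
   Context: Indecomposable means that the only idempotents of $R$ are $0$ and $1$. For a commutative algebra $A$, $E(A)$ is the set of idempotents of $A$, a Boolean algebra under $e\wedge f=ef$, $e\vee f=e+f-ef$ (relative complement $e-ef$). For a Boolean algebra $B$, $\widehat{B}$ is its Stone dual: the set of all ultrafilters in $B$ with the topology having as basis the compact-open sets $O_x=\{\xi\in\widehat{B}: x\in\xi\}$, $x\in B$. A Stone space is a Hausdorff space with a basis of compact-open sets. For a Stone space $X$, $\operatorname{Lc}(X,R)$ is the $R$-algebra of locally constant functions $X\to R$ with compact support, with pointwise operations. $1_U$ denotes the characteristic function of $U$. *)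

theory Defs
  imports "HOL-Analysis.Abstract_Topology" "HOL-Algebra.QuotRing" "HOL-Algebra.Module"
begin

definition idempotents :: "('a, 'm) ring_scheme \<Rightarrow> 'a set"
  where "idempotents A = {e \<in> carrier A. e \<otimes>\<^bsub>A\<^esub> e = e}"

definition indecomposable :: "('a, 'm) ring_scheme \<Rightarrow> bool"
  where "indecomposable R \<longleftrightarrow> idempotents R = {\<zero>\<^bsub>R\<^esub>, \<one>\<^bsub>R\<^esub>}"

text \<open>
  Boolean algebras are understood in the generalized sense (relative complements, a least
  element, but not necessarily a greatest one).
\<close>

record 'b bool_alg = "'b partial_object" +
  bmeet :: "'b \<Rightarrow> 'b \<Rightarrow> 'b"
  bjoin :: "'b \<Rightarrow> 'b \<Rightarrow> 'b"
  bdiff :: "'b \<Rightarrow> 'b \<Rightarrow> 'b"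
  bzero :: 'b

definition idem_bool_alg :: "('a, 'm) ring_scheme \<Rightarrow> 'a bool_alg"
  where "idem_bool_alg A =
    \<lparr>carrier = idempotents A,
     bmeet = (\<lambda>e f. e \<otimes>\<^bsub>A\<^esub> f),
     bjoin = (\<lambda>e f. (e \<oplus>\<^bsub>A\<^esub> f) \<ominus>\<^bsub>A\<^esub> (e \<otimes>\<^bsub>A\<^esub> f)),
     bdiff = (\<lambda>e f. e \<ominus>\<^bsub>A\<^esub> (e \<otimes>\<^bsub>A\<^esub> f)),
     bzero = \<zero>\<^bsub>A\<^esub>\<rparr>"

text \<open>The order of a Boolean algebra is given by \<open>x \<le> y \<longleftrightarrow> x \<and> y = x\<close>.\<close>

definition proper_filter :: "('b, 'm) bool_alg_scheme \<Rightarrow> 'b set \<Rightarrow> bool"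
  where "proper_filter B F \<longleftrightarrow>
    F \<subseteq> carrier B \<and> F \<noteq> {} \<and> bzero B \<notin> F \<and>
    (\<forall>x\<in>F. \<forall>y\<in>F. bmeet B x y \<in> F) \<and>
    (\<forall>x\<in>F. \<forall>y\<in>carrier B. bmeet B x y = x \<longrightarrow> y \<in> F)"

definition ultrafilter_on :: "('b, 'm) bool_alg_scheme \<Rightarrow> 'b set \<Rightarrow> bool"
  where "ultrafilter_on B F \<longleftrightarrow>
    proper_filter B F \<and> (\<forall>G. proper_filter B G \<and> F \<subseteq> G \<longrightarrow> G = F)"

definition stone_open :: "('b, 'm) bool_alg_scheme \<Rightarrow> 'b \<Rightarrow> 'b set set"
  where "stone_open B x = {\<xi>. ultrafilter_on B \<xi> \<and> x \<in> \<xi>}"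

text \<open>
  The sets \<^term>\<open>stone_open B x\<close> are closed under binary intersections (which correspond to meets)
  and cover the set of ultrafilters, so the topology they generate is the one having them as a
  basis, and its underlying space is the set of all ultrafilters.
\<close>

definition stone_dual :: "('b, 'm) bool_alg_scheme \<Rightarrow> 'b set topology"
  where "stone_dual B = topology_generated_by {stone_open B x | x. x \<in> carrier B}"

definition locally_constant_on :: "'x topology \<Rightarrow> ('x \<Rightarrow> 'r) \<Rightarrow> bool"
  where "locally_constant_on X f \<longleftrightarrow>
    (\<forall>x\<in>topspace X. \<exists>U. openin X U \<and> x \<in> U \<and> (\<forall>y\<in>U. f y = f x))"

text \<open>
  Functions are taken to be \<^term>\<open>undefined\<close> off \<^term>\<open>topspace X\<close>, so that they are equal iff
  they agree on \<^term>\<open>topspace X\<close>. The constant function recorded as \<^term>\<open>one\<close> belongs to the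
  carrier (for nonzero \<open>R\<close>) only if \<open>X\<close> is compact; otherwise the algebra has no unit and that
  field has no meaning.
\<close>

definition Lc :: "'x topology \<Rightarrow> ('r, 'm) ring_scheme \<Rightarrow> ('r, 'x \<Rightarrow> 'r) module"
  where "Lc X R =
    \<lparr>carrier = {f \<in> topspace X \<rightarrow>\<^sub>E carrier R. locally_constant_on X f \<and>
        compactin X (X closure_of {x \<in> topspace X. f x \<noteq> \<zero>\<^bsub>R\<^esub>})},
     mult = (\<lambda>f g. \<lambda>x\<in>topspace X. f x \<otimes>\<^bsub>R\<^esub> g x),
     one = (\<lambda>x\<in>topspace X. \<one>\<^bsub>R\<^esub>),
     zero = (\<lambda>x\<in>topspace X. \<zero>\<^bsub>R\<^esub>),
     add = (\<lambda>f g. \<lambda>x\<in>topspace X. f x \<oplus>\<^bsub>R\<^esub> g x),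
     smult = (\<lambda>r f. \<lambda>x\<in>topspace X. r \<otimes>\<^bsub>R\<^esub> f x)\<rparr>"

definition char_fun :: "'x topology \<Rightarrow> ('r, 'm) ring_scheme \<Rightarrow> 'x set \<Rightarrow> 'x \<Rightarrow> 'r"
  where "char_fun X R U = (\<lambda>x\<in>topspace X. if x \<in> U then \<one>\<^bsub>R\<^esub> else \<zero>\<^bsub>R\<^esub>)"

text \<open>
  The free unital associative \<open>R\<close>-algebra on \<open>S\<close> is the monoid algebra of the free monoid on
  \<open>S\<close>: finitely supported \<open>R\<close>-valued functions on words in \<open>S\<close> (extended by zero to all lists),
  multiplied by convolution over the factorizations of a word into a prefix and a suffix.
\<close>

definition free_algebra :: "('r, 'm) ring_scheme \<Rightarrow> 's set \<Rightarrow> ('r, 's list \<Rightarrow> 'r) module"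
  where "free_algebra R S =
    \<lparr>carrier = {f. (\<forall>w. f w \<in> carrier R) \<and> finite {w. f w \<noteq> \<zero>\<^bsub>R\<^esub>} \<and>
        {w. f w \<noteq> \<zero>\<^bsub>R\<^esub>} \<subseteq> lists S},
     mult = (\<lambda>f g w. \<Oplus>\<^bsub>R\<^esub>k\<in>{..length w}. f (take k w) \<otimes>\<^bsub>R\<^esub> g (drop k w)),
     one = (\<lambda>w. if w = [] then \<one>\<^bsub>R\<^esub> else \<zero>\<^bsub>R\<^esub>),
     zero = (\<lambda>w. \<zero>\<^bsub>R\<^esub>),
     add = (\<lambda>f g w. f w \<oplus>\<^bsub>R\<^esub> g w),
     smult = (\<lambda>r f w. r \<otimes>\<^bsub>R\<^esub> f w)\<rparr>"

definition free_gen :: "('r, 'm) ring_scheme \<Rightarrow> 's \<Rightarrow> 's list \<Rightarrow> 'r"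
  where "free_gen R x = (\<lambda>w. if w = [x] then \<one>\<^bsub>R\<^esub> else \<zero>\<^bsub>R\<^esub>)"

definition quotient_algebra :: "('r, 'a) module \<Rightarrow> 'a set \<Rightarrow> ('r, 'a set) module"
  where "quotient_algebra A I = ring.extend (A Quot I)
    (module.fields (\<lambda>r X. \<Union>a\<in>X. I +>\<^bsub>A\<^esub> (r \<odot>\<^bsub>A\<^esub> a)))"

definition idem_relations :: "('r, 'm) ring_scheme \<Rightarrow> 's set \<Rightarrow> 's \<Rightarrow> ('s list \<Rightarrow> 'r) set"
  where "idem_relations R S u =
    (let F = free_algebra R S; g = free_gen R in
      {(g x \<otimes>\<^bsub>F\<^esub> g x) \<ominus>\<^bsub>F\<^esub> g x | x. x \<in> S} \<union>
      {(g x \<otimes>\<^bsub>F\<^esub> g y) \<ominus>\<^bsub>F\<^esub> (g y \<otimes>\<^bsub>F\<^esub> g x) | x y. x \<in> S \<and> y \<in> S} \<union>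
      {g u \<ominus>\<^bsub>F\<^esub> \<one>\<^bsub>F\<^esub>})"

definition idem_ideal :: "('r, 'm) ring_scheme \<Rightarrow> 's set \<Rightarrow> 's \<Rightarrow> ('s list \<Rightarrow> 'r) set"
  where "idem_ideal R S u = Idl\<^bsub>free_algebra R S\<^esub> (idem_relations R S u)"

text \<open>Here \<open>u\<close> is the distinguished element of \<open>S\<close>, which becomes the identity.\<close>

definition idem_algebra ::
    "('r, 'm) ring_scheme \<Rightarrow> 's set \<Rightarrow> 's \<Rightarrow> ('r, ('s list \<Rightarrow> 'r) set) module"
  where "idem_algebra R S u = quotient_algebra (free_algebra R S) (idem_ideal R S u)"

definition idem_gen :: "('r, 'm) ring_scheme \<Rightarrow> 's set \<Rightarrow> 's \<Rightarrow> 's \<Rightarrow> ('s list \<Rightarrow> 'r) set"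
  where "idem_gen R S u x = idem_ideal R S u +>\<^bsub>free_algebra R S\<^esub> free_gen R x"

text \<open>\<^const>\<open>ring_hom\<close> requires the identity to be preserved, so these are unital.\<close>

definition algebra_hom ::
    "('r, 'm) ring_scheme \<Rightarrow> ('r, 'a) module \<Rightarrow> ('r, 'b) module \<Rightarrow> ('a \<Rightarrow> 'b) set"
  where "algebra_hom R A B = {h \<in> ring_hom A B.
    \<forall>r\<in>carrier R. \<forall>a\<in>carrier A. h (r \<odot>\<^bsub>A\<^esub> a) = r \<odot>\<^bsub>B\<^esub> h a}"

definition algebra_iso ::
    "('r, 'm) ring_scheme \<Rightarrow> ('r, 'a) module \<Rightarrow> ('r, 'b) module \<Rightarrow> ('a \<Rightarrow> 'b) set"
  where "algebra_iso R A B = {h \<in> algebra_hom R A B. bij_betw h (carrier A) (carrier B)}"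

end

(*
  A point is a set T with u in T and T a subset of S; it gives the character of A_S that sends
  x in S to 1 if x is in T and to 0 otherwise. For a finite F, the product m of the elements x
  (x in F and in T) and 1 - x (x in F, not in T) is an idempotent, and each a in A_S satisfies
  a m = T(a) m once F is large enough. Since for fixed F these products sum to 1 as T varies, an
  element on which all characters vanish is zero. As R is indecomposable, characters take the
  values 0 and 1 on idempotents, and the ultrafilters of E(A_S) are exactly the sets
  {e. T(e) = 1}. So Psi is "evaluate at all points": it is injective by the above, and it is onto
  because the Stone dual is a continuous image of a power of the two-point space, hence compact,
  so that a locally constant function can be patched together from finitely many idempotents.
*)
theory Submission
  imports Defs "HOL-Analysis.Function_Topology"
begin

section \<open>Algebras generated by idempotents\<close>

text \<open>Two kinds of information about \<open>A_S\<close> are kept apart. Being generated by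
  commuting idempotents bounds it from above: every element is a combination of finitely many
  minterms. Having a character for every \<open>T\<close> with \<open>u \<in> T\<close> bounds it
  from below: the generators satisfy no relations beyond the imposed ones, so \<open>A_S\<close>
  does not collapse. The first locale assumes both, together with the hypotheses on
  \<open>R\<close>, and derives the isomorphism; the presentation serves only to supply them. There
  the obstacle is that \<open>A_S\<close> is a quotient of a noncommutative algebra of words. Its
  commutativity has to be propagated from the generators, and its characters have to be built on
  words and shown to kill the ideal. Finite sets \<open>F\<close> that grow with the element are
  forced because \<open>S\<close> may be infinite, so that no product over all literals exists. Only
  \<open>T\<close> containing \<open>u\<close> occur since \<open>u\<close> becomes the identity;
  this identity is the greatest idempotent, which is what makes a compact Stone dual and a unital
  algebra of functions possible.\<close>

abbreviation self_algebra :: "('r, 'm) ring_scheme \<Rightarrow> ('r, 'r) module"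
  where "self_algebra R \<equiv>
    \<lparr>carrier = carrier R, mult = mult R, one = one R, zero = zero R, add = add R, smult = mult R\<rparr>"

text \<open>\<open>generated\<close> is structural induction over the subalgebra generated by the
  \<open>gen x\<close>. The family \<open>val\<close> stands in for the universal property: no
  relation among the generators can hold that fails at some \<open>T\<close>. Characters map into
  \<open>self_algebra R\<close> because \<open>algebra_hom\<close> expects a module record as
  target.\<close>

locale idem_generated_algebra = R: cring R + A: cring A + algebra R A
  for R :: "('r, 'm) ring_scheme" and A :: "('r, 'a) module" +
  fixes S :: "'s set" and u :: 's and gen :: "'s \<Rightarrow> 'a" and val :: "'s set \<Rightarrow> 'a \<Rightarrow> 'r"
  assumes one_not_zero: "\<one>\<^bsub>R\<^esub> \<noteq> \<zero>\<^bsub>R\<^esub>"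
    and indec: "indecomposable R"
    and u_in: "u \<in> S"
    and gen_closed: "x \<in> S \<Longrightarrow> gen x \<in> carrier A"
    and gen_idem: "x \<in> S \<Longrightarrow> gen x \<otimes>\<^bsub>A\<^esub> gen x = gen x"
    and gen_u: "gen u = \<one>\<^bsub>A\<^esub>"
    and generated: "\<lbrakk>a \<in> carrier A; P \<one>\<^bsub>A\<^esub>; \<And>x. x \<in> S \<Longrightarrow> P (gen x);
      \<And>r b. \<lbrakk>r \<in> carrier R; b \<in> carrier A; P b\<rbrakk> \<Longrightarrow> P (r \<odot>\<^bsub>A\<^esub> b);
      \<And>b c. \<lbrakk>b \<in> carrier A; c \<in> carrier A; P b; P c\<rbrakk> \<Longrightarrow> P (b \<oplus>\<^bsub>A\<^esub> c);
      \<And>b c. \<lbrakk>b \<in> carrier A; c \<in> carrier A; P b; P c\<rbrakk> \<Longrightarrow> P (b \<otimes>\<^bsub>A\<^esub> c)\<rbrakk> \<Longrightarrow> P a"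
    and val_hom: "\<lbrakk>T \<subseteq> S; u \<in> T\<rbrakk> \<Longrightarrow> val T \<in> algebra_hom R A (self_algebra R)"
    and val_gen: "\<lbrakk>T \<subseteq> S; u \<in> T; x \<in> S\<rbrakk> \<Longrightarrow> val T (gen x) = (if x \<in> T then \<one>\<^bsub>R\<^esub> else \<zero>\<^bsub>R\<^esub>)"
begin

abbreviation points :: "'s set set" where "points \<equiv> {T. T \<subseteq> S \<and> u \<in> T}"

lemma val_ring_hom: "T \<in> points \<Longrightarrow> val T \<in> ring_hom A R"
  using val_hom[of T] by (auto simp: algebra_hom_def ring_hom_def)

lemma val_smult:
  "\<lbrakk>T \<in> points; r \<in> carrier R; a \<in> carrier A\<rbrakk> \<Longrightarrow> val T (r \<odot>\<^bsub>A\<^esub> a) = r \<otimes>\<^bsub>R\<^esub> val T a"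
  using val_hom[of T] by (auto simp: algebra_hom_def)

lemma val_closed: "\<lbrakk>T \<in> points; a \<in> carrier A\<rbrakk> \<Longrightarrow> val T a \<in> carrier R"
  by (rule ring_hom_closed[OF val_ring_hom])

lemma val_add: "\<lbrakk>T \<in> points; a \<in> carrier A; b \<in> carrier A\<rbrakk> \<Longrightarrow> val T (a \<oplus>\<^bsub>A\<^esub> b) = val T a \<oplus>\<^bsub>R\<^esub> val T b"
  by (rule ring_hom_add[OF val_ring_hom])

lemma val_mult: "\<lbrakk>T \<in> points; a \<in> carrier A; b \<in> carrier A\<rbrakk> \<Longrightarrow> val T (a \<otimes>\<^bsub>A\<^esub> b) = val T a \<otimes>\<^bsub>R\<^esub> val T b"
  by (rule ring_hom_mult[OF val_ring_hom])

lemma val_one: "T \<in> points \<Longrightarrow> val T \<one>\<^bsub>A\<^esub> = \<one>\<^bsub>R\<^esub>"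
  by (rule ring_hom_one[OF val_ring_hom])

lemma val_zero: "T \<in> points \<Longrightarrow> val T \<zero>\<^bsub>A\<^esub> = \<zero>\<^bsub>R\<^esub>"
  by (rule ring_hom_zero[OF val_ring_hom A.ring_axioms R.ring_axioms])

lemma val_minus:
  assumes "T \<in> points" "a \<in> carrier A" "b \<in> carrier A"
  shows "val T (a \<ominus>\<^bsub>A\<^esub> b) = val T a \<ominus>\<^bsub>R\<^esub> val T b"
proof -
  interpret h: ring_hom_ring A R "val T"
    by (rule ring_hom_ringI2) (use val_ring_hom assms A.ring_axioms R.ring_axioms in auto)
  show ?thesis
    using assms by (simp add: a_minus_def)
qed

section \<open>Literals and minterms over finite sets of generators\<close>

definition lit :: "'s set \<Rightarrow> 's \<Rightarrow> 'a"
  where "lit T x = (if x \<in> T then gen x else \<one>\<^bsub>A\<^esub> \<ominus>\<^bsub>A\<^esub> gen x)"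

definition minterm :: "'s set \<Rightarrow> 's set \<Rightarrow> 'a"
  where "minterm F T = finprod A (lit T) F"

lemma lit_closed: "x \<in> S \<Longrightarrow> lit T x \<in> carrier A"
  using gen_closed by (simp add: lit_def)

lemma minterm_closed: "F \<subseteq> S \<Longrightarrow> minterm F T \<in> carrier A"
  unfolding minterm_def by (rule A.finprod_closed) (use lit_closed in auto)

lemma minterm_empty: "minterm {} T = \<one>\<^bsub>A\<^esub>"
  by (simp add: minterm_def)

lemma minterm_insert:
  "\<lbrakk>finite F; F \<subseteq> S; x \<in> S; x \<notin> F\<rbrakk> \<Longrightarrow> minterm (insert x F) T = lit T x \<otimes>\<^bsub>A\<^esub> minterm F T"
  unfolding minterm_def by (rule A.finprod_insert) (use lit_closed in auto)

lemma minterm_split: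
  assumes "finite G" "G \<subseteq> S" "F \<subseteq> G"
  shows "minterm G T = minterm F T \<otimes>\<^bsub>A\<^esub> minterm (G - F) T"
proof -
  have "finprod A (lit T) (F \<union> (G - F)) = finprod A (lit T) F \<otimes>\<^bsub>A\<^esub> finprod A (lit T) (G - F)"
    by (rule A.finprod_Un_disjoint) (use assms lit_closed in \<open>auto intro: finite_subset\<close>)
  then show ?thesis
    using assms by (simp add: minterm_def Un_absorb1)
qed

text \<open>A minterm sees \<open>T\<close> only through \<open>T \<inter> F\<close>. This lets
  \<open>T\<close> be changed off \<open>F\<close>, both when a generator is eliminated and when a
  neighbourhood is described by finitely many coordinates.\<close>

lemma minterm_cong:
  assumes "F \<subseteq> S" "T \<inter> F = T' \<inter> F"
  shows "minterm F T = minterm F T'"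
  unfolding minterm_def
  by (rule A.finprod_cong) (use assms lit_closed in \<open>auto simp: lit_def simp_implies_def\<close>)

lemma val_lit: "\<lbrakk>T \<in> points; x \<in> S\<rbrakk> \<Longrightarrow> val T (lit T x) = \<one>\<^bsub>R\<^esub>"
  by (auto simp: lit_def val_minus gen_closed val_one val_gen) (simp add: a_minus_def)

lemma val_minterm:
  assumes "T \<in> points"
  shows "\<lbrakk>finite F; F \<subseteq> S\<rbrakk> \<Longrightarrow> val T (minterm F T) = \<one>\<^bsub>R\<^esub>"
  by (induction F rule: finite_induct)
    (use assms in \<open>auto simp: minterm_empty val_one minterm_insert val_mult val_lit lit_closed minterm_closed\<close>)

lemma compl_idem:
  assumes "e \<in> idempotents A"
  shows "\<one>\<^bsub>A\<^esub> \<ominus>\<^bsub>A\<^esub> e \<in> idempotents A"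
proof -
  have e: "e \<in> carrier A" "e \<otimes>\<^bsub>A\<^esub> e = e"
    using assms by (auto simp: idempotents_def)
  have "(\<one>\<^bsub>A\<^esub> \<ominus>\<^bsub>A\<^esub> e) \<otimes>\<^bsub>A\<^esub> (\<one>\<^bsub>A\<^esub> \<ominus>\<^bsub>A\<^esub> e) = \<one>\<^bsub>A\<^esub> \<ominus>\<^bsub>A\<^esub> e \<ominus>\<^bsub>A\<^esub> e \<oplus>\<^bsub>A\<^esub> e \<otimes>\<^bsub>A\<^esub> e"
    using e(1) by algebra
  also have "\<dots> = \<one>\<^bsub>A\<^esub> \<ominus>\<^bsub>A\<^esub> e"
    unfolding e(2) using e(1) by algebra
  finally show ?thesis
    using e(1) by (simp add: idempotents_def)
qed

lemma mult_idem:
  assumes "e \<in> idempotents A" "f \<in> idempotents A"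
  shows "e \<otimes>\<^bsub>A\<^esub> f \<in> idempotents A"
proof -
  have e: "e \<in> carrier A" "e \<otimes>\<^bsub>A\<^esub> e = e" "f \<in> carrier A" "f \<otimes>\<^bsub>A\<^esub> f = f"
    using assms by (auto simp: idempotents_def)
  have "(e \<otimes>\<^bsub>A\<^esub> f) \<otimes>\<^bsub>A\<^esub> (e \<otimes>\<^bsub>A\<^esub> f) = (e \<otimes>\<^bsub>A\<^esub> e) \<otimes>\<^bsub>A\<^esub> (f \<otimes>\<^bsub>A\<^esub> f)"
    using e(1,3) by algebra
  then show ?thesis
    using e by (simp add: idempotents_def)
qed

lemma gen_idempotent: "x \<in> S \<Longrightarrow> gen x \<in> idempotents A"
  using gen_closed gen_idem by (simp add: idempotents_def)

lemma minterm_idem: "\<lbrakk>finite F; F \<subseteq> S\<rbrakk> \<Longrightarrow> minterm F T \<in> idempotents A"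
proof (induction F rule: finite_induct)
  case empty
  show ?case
    by (simp add: minterm_empty idempotents_def)
next
  case (insert x F)
  have "lit T x \<in> idempotents A"
    using insert.prems gen_idempotent compl_idem by (simp add: lit_def)
  then show ?case
    using insert mult_idem by (simp add: minterm_insert)
qed

text \<open>One \<open>F\<close> has to serve all points \<open>T\<close> at once: this uniformity
  lets \<open>a\<close> be controlled by its products with the minterms over a single finite
  set.\<close>

definition determined_by :: "'s set \<Rightarrow> 'a \<Rightarrow> bool"
  where "determined_by F a \<longleftrightarrow> finite F \<and> F \<subseteq> S \<and>
    (\<forall>T\<in>points. a \<otimes>\<^bsub>A\<^esub> minterm F T = val T a \<odot>\<^bsub>A\<^esub> minterm F T)"

text \<open>The minterm over \<open>G\<close> is a multiple of the one over \<open>F\<close>, so the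
  equation survives. Serves to put two elements over a common finite set.\<close>

lemma determined_by_mono:
  assumes "determined_by F a" "a \<in> carrier A" "F \<subseteq> G" "finite G" "G \<subseteq> S"
  shows "determined_by G a"
  unfolding determined_by_def
proof (intro conjI ballI)
  fix T assume T: "T \<in> points"
  let ?m = "minterm F T" and ?n = "minterm (G - F) T"
  have c: "?m \<in> carrier A" "?n \<in> carrier A"
    using assms by (auto intro!: minterm_closed)
  have "a \<otimes>\<^bsub>A\<^esub> (?m \<otimes>\<^bsub>A\<^esub> ?n) = (a \<otimes>\<^bsub>A\<^esub> ?m) \<otimes>\<^bsub>A\<^esub> ?n"
    by (rule A.m_assoc[symmetric, OF assms(2) c])
  also have "\<dots> = (val T a \<odot>\<^bsub>A\<^esub> ?m) \<otimes>\<^bsub>A\<^esub> ?n"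
    using assms(1) T by (simp add: determined_by_def)
  also have "\<dots> = val T a \<odot>\<^bsub>A\<^esub> (?m \<otimes>\<^bsub>A\<^esub> ?n)"
    using c val_closed[OF T assms(2)] by (simp add: smult_assoc2)
  finally show "a \<otimes>\<^bsub>A\<^esub> minterm G T = val T a \<odot>\<^bsub>A\<^esub> minterm G T"
    using assms(3-5) minterm_split by simp
qed (use assms in auto)

text \<open>A generator is determined by itself alone, since multiplied by its literal it gives 1 or
  0 times that literal. For sums and products the union of the two finite sets works, because
  \<open>val T\<close> is a homomorphism.\<close>

lemma finitely_determined:
  assumes "a \<in> carrier A"
  shows "\<exists>F. determined_by F a"
  using assms
proof (rule generated)
  show "\<exists>F. determined_by F \<one>\<^bsub>A\<^esub>"
    by (rule exI[of _ "{}"]) (auto simp: determined_by_def minterm_empty val_one)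
next
  fix x assume x: "x \<in> S"
  have "gen x \<otimes>\<^bsub>A\<^esub> minterm {x} T = val T (gen x) \<odot>\<^bsub>A\<^esub> minterm {x} T" if T: "T \<in> points" for T
  proof -
    have m: "minterm {x} T = lit T x"
      using minterm_insert[of "{}" x T] x by (simp add: minterm_empty lit_closed)
    have "gen x \<otimes>\<^bsub>A\<^esub> (\<one>\<^bsub>A\<^esub> \<ominus>\<^bsub>A\<^esub> gen x) = gen x \<ominus>\<^bsub>A\<^esub> gen x \<otimes>\<^bsub>A\<^esub> gen x"
      using gen_closed[OF x] by algebra
    also have "\<dots> = \<zero>\<^bsub>A\<^esub>"
      using gen_closed[OF x] by (simp add: gen_idem[OF x] a_minus_def A.r_neg)
    finally show ?thesis
      using T x gen_closed by (auto simp: m lit_def val_gen gen_idem)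
  qed
  then show "\<exists>F. determined_by F (gen x)"
    using x by (intro exI[of _ "{x}"]) (auto simp: determined_by_def)
next
  fix r b assume b: "r \<in> carrier R" "b \<in> carrier A" and "\<exists>F. determined_by F b"
  then obtain F where F: "determined_by F b"
    by blast
  then have "(r \<odot>\<^bsub>A\<^esub> b) \<otimes>\<^bsub>A\<^esub> minterm F T = val T (r \<odot>\<^bsub>A\<^esub> b) \<odot>\<^bsub>A\<^esub> minterm F T"
    if T: "T \<in> points" for T
    using b T val_closed[OF T b(2)] val_smult[OF T b]
    by (simp add: determined_by_def smult_assoc2 minterm_closed smult_assoc1)
  then show "\<exists>F. determined_by F (r \<odot>\<^bsub>A\<^esub> b)"
    using F unfolding determined_by_def by blast
next
  fix b c assume b: "b \<in> carrier A" "c \<in> carrier A"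
    and "\<exists>F. determined_by F b" "\<exists>F. determined_by F c"
  then obtain F G where F: "determined_by F b" "determined_by G c"
    by blast
  define H where "H = F \<union> G"
  have H: "finite H" "H \<subseteq> S" "F \<subseteq> H" "G \<subseteq> H"
    using F by (auto simp: H_def determined_by_def)
  have eb: "b \<otimes>\<^bsub>A\<^esub> minterm H T = val T b \<odot>\<^bsub>A\<^esub> minterm H T"
    and ec: "c \<otimes>\<^bsub>A\<^esub> minterm H T = val T c \<odot>\<^bsub>A\<^esub> minterm H T" if "T \<in> points" for T
    using determined_by_mono[OF F(1) b(1) H(3,1,2)] determined_by_mono[OF F(2) b(2) H(4,1,2)] that
    unfolding determined_by_def by auto
  have m: "minterm H T \<in> carrier A" for T
    using H minterm_closed by blast
  have "(b \<oplus>\<^bsub>A\<^esub> c) \<otimes>\<^bsub>A\<^esub> minterm H T = val T (b \<oplus>\<^bsub>A\<^esub> c) \<odot>\<^bsub>A\<^esub> minterm H T"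
    if T: "T \<in> points" for T
    unfolding val_add[OF T b] A.l_distr[OF b m] eb[OF T] ec[OF T]
    by (rule smult_l_distr[symmetric]) (use b T m val_closed in auto)
  then show "\<exists>F. determined_by F (b \<oplus>\<^bsub>A\<^esub> c)"
    using H unfolding determined_by_def by blast
  have "(b \<otimes>\<^bsub>A\<^esub> c) \<otimes>\<^bsub>A\<^esub> minterm H T = val T (b \<otimes>\<^bsub>A\<^esub> c) \<odot>\<^bsub>A\<^esub> minterm H T"
    if T: "T \<in> points" for T
  proof -
    have v: "val T b \<in> carrier R" "val T c \<in> carrier R"
      using val_closed T b by auto
    have "(b \<otimes>\<^bsub>A\<^esub> c) \<otimes>\<^bsub>A\<^esub> minterm H T = (c \<otimes>\<^bsub>A\<^esub> minterm H T) \<otimes>\<^bsub>A\<^esub> b"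
      using b m[of T] by algebra
    also have "\<dots> = val T c \<odot>\<^bsub>A\<^esub> (minterm H T \<otimes>\<^bsub>A\<^esub> b)"
      unfolding ec[OF T] by (rule smult_assoc2[OF v(2) m b(1)])
    also have "\<dots> = val T c \<odot>\<^bsub>A\<^esub> (val T b \<odot>\<^bsub>A\<^esub> minterm H T)"
      unfolding A.m_comm[OF m b(1)] eb[OF T] ..
    also have "\<dots> = val T (b \<otimes>\<^bsub>A\<^esub> c) \<odot>\<^bsub>A\<^esub> minterm H T"
      unfolding val_mult[OF T b] R.m_comm[OF v] by (rule smult_assoc1[symmetric, OF v(2,1) m])
    finally show ?thesis .
  qed
  then show "\<exists>F. determined_by F (b \<otimes>\<^bsub>A\<^esub> c)"
    using H unfolding determined_by_def by blast
qed

text \<open>Generators are removed from \<open>F\<close> one at a time: for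
  \<open>x \<notin> F\<close> the minterm of \<open>T\<close> over \<open>F\<close> is the sum of
  the minterms of \<open>insert x T\<close> and \<open>T - {x}\<close> over
  \<open>insert x F\<close>. This replaces an expansion of 1 over all subsets of
  \<open>F\<close>.\<close>

lemma zero_if_minterms_zero:
  assumes "finite F" "F \<subseteq> S" "a \<in> carrier A"
    and "\<And>T. T \<in> points \<Longrightarrow> a \<otimes>\<^bsub>A\<^esub> minterm F T = \<zero>\<^bsub>A\<^esub>"
  shows "a = \<zero>\<^bsub>A\<^esub>"
  using assms
proof (induction F rule: finite_induct)
  case empty
  \<comment> \<open>The empty minterm is 1, so a single point suffices; \<open>{u}\<close> is the
    smallest.\<close>
  from empty(3)[of "{u}"] empty(2) show ?case
    using u_in by (simp add: minterm_empty)
next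
  case (insert x F)
  then have x: "x \<in> S" "x \<notin> F" and F: "F \<subseteq> S" and a: "a \<in> carrier A"
    by auto
  have *: "a \<otimes>\<^bsub>A\<^esub> (lit T x \<otimes>\<^bsub>A\<^esub> minterm F T) = \<zero>\<^bsub>A\<^esub>" if "T \<in> points" for T
    using insert.prems(3)[OF that] insert.hyps F x by (simp add: minterm_insert)
  show ?case
  proof (rule insert.IH[OF F a])
    fix T assume T: "T \<in> points"
    let ?m = "minterm F T"
    have m: "?m \<in> carrier A"
      using F minterm_closed by blast
    have c: "minterm F (insert x T) = ?m" "minterm F (T - {x}) = ?m"
      using F x by (auto intro!: minterm_cong)
    have 1: "a \<otimes>\<^bsub>A\<^esub> (gen x \<otimes>\<^bsub>A\<^esub> ?m) = \<zero>\<^bsub>A\<^esub>"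
      using *[of "insert x T"] T x by (auto simp: c lit_def)
    show "a \<otimes>\<^bsub>A\<^esub> ?m = \<zero>\<^bsub>A\<^esub>"
    \<comment> \<open>\<open>T - {u}\<close> is not a point, but \<open>gen u\<close> is already 1,
      so one of the two halves is enough.\<close>
    proof (cases "x = u")
      case True
      then show ?thesis
        using 1 m by (simp add: gen_u)
    next
      case False
      have 2: "a \<otimes>\<^bsub>A\<^esub> ((\<one>\<^bsub>A\<^esub> \<ominus>\<^bsub>A\<^esub> gen x) \<otimes>\<^bsub>A\<^esub> ?m) = \<zero>\<^bsub>A\<^esub>"
        using *[of "T - {x}"] T False by (auto simp: c lit_def)
      have "a \<otimes>\<^bsub>A\<^esub> ?m =
          a \<otimes>\<^bsub>A\<^esub> (gen x \<otimes>\<^bsub>A\<^esub> ?m) \<oplus>\<^bsub>A\<^esub> a \<otimes>\<^bsub>A\<^esub> ((\<one>\<^bsub>A\<^esub> \<ominus>\<^bsub>A\<^esub> gen x) \<otimes>\<^bsub>A\<^esub> ?m)"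
        using a m gen_closed[OF x(1)] by algebra
      then show ?thesis
        unfolding 1 2 by simp
    qed
  qed
qed

lemma eq_if_val_eq:
  assumes a: "a \<in> carrier A" "b \<in> carrier A" and eq: "\<And>T. T \<in> points \<Longrightarrow> val T a = val T b"
  shows "a = b"
proof -
  have c: "a \<ominus>\<^bsub>A\<^esub> b \<in> carrier A"
    using a by simp
  obtain F where F: "determined_by F (a \<ominus>\<^bsub>A\<^esub> b)"
    using finitely_determined[OF c] by blast
  have 0: "val T (a \<ominus>\<^bsub>A\<^esub> b) = \<zero>\<^bsub>R\<^esub>" if "T \<in> points" for T
    unfolding val_minus[OF that a] eq[OF that]
    using val_closed[OF that a(2)] by (simp add: a_minus_def R.r_neg)
  have "a \<ominus>\<^bsub>A\<^esub> b = \<zero>\<^bsub>A\<^esub>"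
  proof (rule zero_if_minterms_zero)
    show "finite F" "F \<subseteq> S" "a \<ominus>\<^bsub>A\<^esub> b \<in> carrier A"
      using F c by (auto simp: determined_by_def)
    then show "(a \<ominus>\<^bsub>A\<^esub> b) \<otimes>\<^bsub>A\<^esub> minterm F T = \<zero>\<^bsub>A\<^esub>" if T: "T \<in> points" for T
      using F T 0[OF T] minterm_closed[of F T] by (simp add: determined_by_def)
  qed
  moreover have "a = (a \<ominus>\<^bsub>A\<^esub> b) \<oplus>\<^bsub>A\<^esub> b"
    using a by algebra
  ultimately show ?thesis
    using a by simp
qed

text \<open>Here indecomposability enters: the value is an idempotent of \<open>R\<close>. A
  nontrivial idempotent \<open>r\<close> of \<open>R\<close> would break the claim through the
  idempotent \<open>r\<close> times 1 of \<open>A\<close>.\<close>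

lemma val_idem:
  assumes "T \<in> points" "e \<in> idempotents A"
  shows "val T e = \<zero>\<^bsub>R\<^esub> \<or> val T e = \<one>\<^bsub>R\<^esub>"
proof -
  have e: "e \<in> carrier A" "e \<otimes>\<^bsub>A\<^esub> e = e"
    using assms by (auto simp: idempotents_def)
  then have "val T e \<otimes>\<^bsub>R\<^esub> val T e = val T e"
    using val_mult[OF assms(1), of e e] by simp
  then have "val T e \<in> idempotents R"
    using val_closed[OF assms(1) e(1)] by (simp add: idempotents_def)
  then show ?thesis
    using indec by (simp add: indecomposable_def)
qed

section \<open>Ultrafilters of idempotents\<close>

definition pt :: "'s set \<Rightarrow> 'a set"
  where "pt T = {e \<in> idempotents A. val T e = \<one>\<^bsub>R\<^esub>}"

lemma bool_alg_simps [simp]: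
  "carrier (idem_bool_alg A) = idempotents A"
  "bmeet (idem_bool_alg A) = (\<otimes>\<^bsub>A\<^esub>)"
  "bzero (idem_bool_alg A) = \<zero>\<^bsub>A\<^esub>"
  by (auto simp: idem_bool_alg_def)

lemma idem_closed: "e \<in> idempotents A \<Longrightarrow> e \<in> carrier A"
  by (simp add: idempotents_def)

lemma one_idem: "\<one>\<^bsub>A\<^esub> \<in> idempotents A"
  by (simp add: idempotents_def)

lemma idem_mult_compl:
  assumes "e \<in> idempotents A"
  shows "e \<otimes>\<^bsub>A\<^esub> (\<one>\<^bsub>A\<^esub> \<ominus>\<^bsub>A\<^esub> e) = \<zero>\<^bsub>A\<^esub>"
proof -
  have e: "e \<in> carrier A" "e \<otimes>\<^bsub>A\<^esub> e = e"
    using assms by (auto simp: idempotents_def)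
  have "e \<otimes>\<^bsub>A\<^esub> (\<one>\<^bsub>A\<^esub> \<ominus>\<^bsub>A\<^esub> e) = e \<ominus>\<^bsub>A\<^esub> e \<otimes>\<^bsub>A\<^esub> e"
    using e(1) by algebra
  also have "\<dots> = \<zero>\<^bsub>A\<^esub>"
    unfolding e(2) using e(1) by (simp add: a_minus_def A.r_neg)
  finally show ?thesis .
qed

lemma proper_filter_pt:
  assumes T: "T \<in> points"
  shows "proper_filter (idem_bool_alg A) (pt T)"
  unfolding proper_filter_def bool_alg_simps
proof (intro conjI ballI impI)
  have "\<one>\<^bsub>A\<^esub> \<in> pt T"
    using one_idem val_one[OF T] by (simp add: pt_def)
  then show "pt T \<noteq> {}"
    by blast
  show "\<zero>\<^bsub>A\<^esub> \<notin> pt T"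
    using val_zero[OF T] one_not_zero by (simp add: pt_def)
next
  fix x y assume "x \<in> pt T" "y \<in> pt T"
  then show "x \<otimes>\<^bsub>A\<^esub> y \<in> pt T"
    using val_mult[OF T, of x y] mult_idem[of x y] by (simp add: pt_def idem_closed)
next
  fix x y assume x: "x \<in> pt T" and y: "y \<in> idempotents A" "x \<otimes>\<^bsub>A\<^esub> y = x"
  have "val T x \<otimes>\<^bsub>R\<^esub> val T y = val T x"
    using val_mult[OF T, of x y] x y by (simp add: pt_def idem_closed)
  then show "y \<in> pt T"
    using x y val_closed[OF T idem_closed[OF y(1)]] by (simp add: pt_def)
qed (auto simp: pt_def)

text \<open>An idempotent outside \<open>pt T\<close> has value 0, so its complement lies in
  \<open>pt T\<close>; a filter containing both contains their product, which is zero.\<close>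

lemma ultrafilter_pt:
  assumes T: "T \<in> points"
  shows "ultrafilter_on (idem_bool_alg A) (pt T)"
  unfolding ultrafilter_on_def
proof (intro conjI allI impI proper_filter_pt[OF T])
  fix G assume G: "proper_filter (idem_bool_alg A) G \<and> pt T \<subseteq> G"
  have "e \<in> pt T" if e: "e \<in> G" for e
  proof (rule ccontr)
    have i: "e \<in> idempotents A"
      using e G by (auto simp: proper_filter_def)
    assume "e \<notin> pt T"
    then have "val T e = \<zero>\<^bsub>R\<^esub>"
      using i val_idem[OF T i] by (simp add: pt_def)
    then have "val T (\<one>\<^bsub>A\<^esub> \<ominus>\<^bsub>A\<^esub> e) = \<one>\<^bsub>R\<^esub>"
      unfolding val_minus[OF T A.one_closed idem_closed[OF i]] val_one[OF T]
      by (simp add: a_minus_def)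
    then have "\<one>\<^bsub>A\<^esub> \<ominus>\<^bsub>A\<^esub> e \<in> G"
      using G compl_idem[OF i] by (auto simp: pt_def)
    then have "e \<otimes>\<^bsub>A\<^esub> (\<one>\<^bsub>A\<^esub> \<ominus>\<^bsub>A\<^esub> e) \<in> G"
      using e G by (simp add: proper_filter_def)
    then show False
      using G idem_mult_compl[OF i] by (simp add: proper_filter_def)
  qed
  then show "G = pt T"
    using G by blast
qed

text \<open>The usual argument that ultrafilters are prime: maximality is tested against the filter
  generated by \<open>\<xi>\<close> and the complement of \<open>e\<close>.\<close>

lemma ultrafilter_compl:
  assumes U: "ultrafilter_on (idem_bool_alg A) \<xi>" and e: "e \<in> idempotents A" "e \<notin> \<xi>"
  shows "\<one>\<^bsub>A\<^esub> \<ominus>\<^bsub>A\<^esub> e \<in> \<xi>"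
proof -
  let ?c = "\<one>\<^bsub>A\<^esub> \<ominus>\<^bsub>A\<^esub> e"
  \<comment> \<open>The generated filter: all idempotents above some \<open>z \<otimes> ?c\<close>
    with \<open>z \<in> \<xi>\<close>.\<close>
  define G where "G = {y \<in> idempotents A. \<exists>z\<in>\<xi>. (z \<otimes>\<^bsub>A\<^esub> ?c) \<otimes>\<^bsub>A\<^esub> y = z \<otimes>\<^bsub>A\<^esub> ?c}"
  have \<xi>: "\<xi> \<subseteq> idempotents A" "\<xi> \<noteq> {}" "\<zero>\<^bsub>A\<^esub> \<notin> \<xi>"
    "\<And>x y. \<lbrakk>x \<in> \<xi>; y \<in> \<xi>\<rbrakk> \<Longrightarrow> x \<otimes>\<^bsub>A\<^esub> y \<in> \<xi>"
    "\<And>x y. \<lbrakk>x \<in> \<xi>; y \<in> idempotents A; x \<otimes>\<^bsub>A\<^esub> y = x\<rbrakk> \<Longrightarrow> y \<in> \<xi>"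
    and max: "\<And>G. \<lbrakk>proper_filter (idem_bool_alg A) G; \<xi> \<subseteq> G\<rbrakk> \<Longrightarrow> G = \<xi>"
    using U by (auto simp: ultrafilter_on_def proper_filter_def)
  have cc: "?c \<in> idempotents A"
    by (rule compl_idem[OF e(1)])
  have carr: "e \<in> carrier A" "?c \<in> carrier A" "\<And>z. z \<in> \<xi> \<Longrightarrow> z \<in> carrier A"
    using e(1) cc \<xi>(1) idem_closed by blast+
  have sub: "\<xi> \<subseteq> G"
  proof
    fix z assume z: "z \<in> \<xi>"
    then have zi: "z \<in> carrier A" "z \<otimes>\<^bsub>A\<^esub> z = z"
      using \<xi>(1) by (auto simp: idempotents_def)
    have "(z \<otimes>\<^bsub>A\<^esub> ?c) \<otimes>\<^bsub>A\<^esub> z = (z \<otimes>\<^bsub>A\<^esub> z) \<otimes>\<^bsub>A\<^esub> ?c"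
      using zi(1) carr by algebra
    then show "z \<in> G"
      using z zi(2) \<xi>(1) by (auto simp: G_def)
  qed
  obtain z0 where z0: "z0 \<in> \<xi>"
    using \<xi>(2) by blast
  have "(z0 \<otimes>\<^bsub>A\<^esub> ?c) \<otimes>\<^bsub>A\<^esub> ?c = z0 \<otimes>\<^bsub>A\<^esub> (?c \<otimes>\<^bsub>A\<^esub> ?c)"
    using A.m_assoc carr z0 by blast
  also have "\<dots> = z0 \<otimes>\<^bsub>A\<^esub> ?c"
    using cc by (simp add: idempotents_def)
  finally have cG: "?c \<in> G"
    using z0 cc by (auto simp: G_def)
  have "proper_filter (idem_bool_alg A) G"
    unfolding proper_filter_def bool_alg_simps
  proof (intro conjI ballI impI)
    show "G \<subseteq> idempotents A"
      by (auto simp: G_def)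
    show "G \<noteq> {}"
      using cG by blast
    show "\<zero>\<^bsub>A\<^esub> \<notin> G"
    proof
      assume "\<zero>\<^bsub>A\<^esub> \<in> G"
      then obtain z where z: "z \<in> \<xi>" "(z \<otimes>\<^bsub>A\<^esub> ?c) \<otimes>\<^bsub>A\<^esub> \<zero>\<^bsub>A\<^esub> = z \<otimes>\<^bsub>A\<^esub> ?c"
        by (auto simp: G_def)
      then have 0: "z \<otimes>\<^bsub>A\<^esub> ?c = \<zero>\<^bsub>A\<^esub>"
        using carr by simp
      \<comment> \<open>If \<open>z\<close> is disjoint from the complement of \<open>e\<close>,
        then \<open>z\<close> lies below \<open>e\<close>, which forces
        \<open>e \<in> \<xi>\<close>.\<close>
      have "z = z \<otimes>\<^bsub>A\<^esub> e \<oplus>\<^bsub>A\<^esub> z \<otimes>\<^bsub>A\<^esub> ?c"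
        using carr(1) carr(3)[OF z(1)] by algebra
      then have "z \<otimes>\<^bsub>A\<^esub> e = z"
        unfolding 0 using carr(1) carr(3)[OF z(1)] by simp
      then show False
        using \<xi>(5) z(1) e by blast
    qed
  next
    fix x y assume "x \<in> G" "y \<in> G"
    then obtain z w where z: "z \<in> \<xi>" "(z \<otimes>\<^bsub>A\<^esub> ?c) \<otimes>\<^bsub>A\<^esub> x = z \<otimes>\<^bsub>A\<^esub> ?c"
      and w: "w \<in> \<xi>" "(w \<otimes>\<^bsub>A\<^esub> ?c) \<otimes>\<^bsub>A\<^esub> y = w \<otimes>\<^bsub>A\<^esub> ?c"
      and xy: "x \<in> idempotents A" "y \<in> idempotents A"
      by (auto simp: G_def)
    note c = carr(2) carr(3)[OF z(1)] carr(3)[OF w(1)] xy[THEN idem_closed]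
    have "((z \<otimes>\<^bsub>A\<^esub> w) \<otimes>\<^bsub>A\<^esub> ?c) \<otimes>\<^bsub>A\<^esub> (x \<otimes>\<^bsub>A\<^esub> y) = ((z \<otimes>\<^bsub>A\<^esub> ?c) \<otimes>\<^bsub>A\<^esub> x) \<otimes>\<^bsub>A\<^esub> (w \<otimes>\<^bsub>A\<^esub> y)"
      using c by (simp add: A.m_ac)
    also have "\<dots> = z \<otimes>\<^bsub>A\<^esub> ((w \<otimes>\<^bsub>A\<^esub> ?c) \<otimes>\<^bsub>A\<^esub> y)"
      unfolding z(2) using c by (simp add: A.m_ac)
    also have "\<dots> = (z \<otimes>\<^bsub>A\<^esub> w) \<otimes>\<^bsub>A\<^esub> ?c"
      unfolding w(2) using c by (simp add: A.m_ac)
    finally show "x \<otimes>\<^bsub>A\<^esub> y \<in> G"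
      using mult_idem[OF xy] \<xi>(4)[OF z(1) w(1)] by (auto simp: G_def)
  next
    fix x y assume "x \<in> G" and y: "y \<in> idempotents A" "x \<otimes>\<^bsub>A\<^esub> y = x"
    then obtain z where z: "z \<in> \<xi>" "(z \<otimes>\<^bsub>A\<^esub> ?c) \<otimes>\<^bsub>A\<^esub> x = z \<otimes>\<^bsub>A\<^esub> ?c" and x: "x \<in> idempotents A"
      by (auto simp: G_def)
    have c: "z \<otimes>\<^bsub>A\<^esub> ?c \<in> carrier A"
      using carr(2) carr(3)[OF z(1)] by simp
    have "(z \<otimes>\<^bsub>A\<^esub> ?c) \<otimes>\<^bsub>A\<^esub> y = (z \<otimes>\<^bsub>A\<^esub> ?c) \<otimes>\<^bsub>A\<^esub> (x \<otimes>\<^bsub>A\<^esub> y)"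
      using A.m_assoc[OF c x[THEN idem_closed] y(1)[THEN idem_closed]] z(2) by simp
    then show "y \<in> G"
      unfolding y(2) z(2) using z(1) y(1) by (auto simp: G_def)
  qed
  then have "G = \<xi>"
    using max sub by blast
  then show ?thesis
    using cG by simp
qed

text \<open>By primeness \<open>\<xi>\<close> contains every literal of \<open>T\<close>, hence
  every minterm. If \<open>e \<in> \<xi>\<close>, the product of \<open>e\<close> with a fine enough
  minterm lies in \<open>\<xi>\<close> and equals \<open>val T e\<close> times that minterm, so
  \<open>val T e\<close> is nonzero and thus 1. Maximality turns the inclusion in
  \<open>pt T\<close> into equality.\<close>

lemma ultrafilter_eq_pt:
  assumes U: "ultrafilter_on (idem_bool_alg A) \<xi>"
  shows "{x \<in> S. gen x \<in> \<xi>} \<in> points \<and> \<xi> = pt {x \<in> S. gen x \<in> \<xi>}"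
proof -
  define T where "T = {x \<in> S. gen x \<in> \<xi>}"
  have \<xi>: "\<xi> \<subseteq> idempotents A" "\<xi> \<noteq> {}" "\<zero>\<^bsub>A\<^esub> \<notin> \<xi>"
    "\<And>x y. \<lbrakk>x \<in> \<xi>; y \<in> \<xi>\<rbrakk> \<Longrightarrow> x \<otimes>\<^bsub>A\<^esub> y \<in> \<xi>"
    "\<And>x y. \<lbrakk>x \<in> \<xi>; y \<in> idempotents A; x \<otimes>\<^bsub>A\<^esub> y = x\<rbrakk> \<Longrightarrow> y \<in> \<xi>"
    and max: "\<And>G. \<lbrakk>proper_filter (idem_bool_alg A) G; \<xi> \<subseteq> G\<rbrakk> \<Longrightarrow> G = \<xi>"
    using U by (auto simp: ultrafilter_on_def proper_filter_def)
  obtain z where "z \<in> \<xi>"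
    using \<xi>(2) by blast
  then have one: "\<one>\<^bsub>A\<^esub> \<in> \<xi>"
    using \<xi>(5)[of z "\<one>\<^bsub>A\<^esub>"] \<xi>(1) one_idem by (auto simp: idem_closed)
  then have T: "T \<in> points"
    using u_in gen_u by (auto simp: T_def)
  have lit: "lit T x \<in> \<xi>" if "x \<in> S" for x
    using that ultrafilter_compl[OF U gen_idempotent[OF that]] by (auto simp: lit_def T_def)
  have m: "minterm F T \<in> \<xi>" if "finite F" "F \<subseteq> S" for F
    using that by (induction F rule: finite_induct) (auto simp: minterm_empty one minterm_insert \<xi>(4) lit)
  have "\<xi> \<subseteq> pt T"
  proof
    fix e assume e: "e \<in> \<xi>"
    then have i: "e \<in> idempotents A"
      using \<xi>(1) by blast
    obtain F where F: "determined_by F e"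
      using finitely_determined[OF idem_closed[OF i]] by blast
    then have F': "minterm F T \<in> \<xi>" "minterm F T \<in> carrier A"
      using m minterm_closed by (auto simp: determined_by_def)
    have "val T e \<odot>\<^bsub>A\<^esub> minterm F T \<in> \<xi>"
      using \<xi>(4)[OF e F'(1)] F T by (simp add: determined_by_def)
    then have "val T e \<noteq> \<zero>\<^bsub>R\<^esub>"
      using F'(2) \<xi>(3) by auto
    then show "e \<in> pt T"
      using val_idem[OF T i] i by (auto simp: pt_def)
  qed
  then have "pt T = \<xi>"
    using max proper_filter_pt[OF T] by blast
  then show ?thesis
    using T by (simp add: T_def)
qed

lemma gen_in_pt: "\<lbrakk>T \<in> points; x \<in> S\<rbrakk> \<Longrightarrow> gen x \<in> pt T \<longleftrightarrow> x \<in> T"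
  using one_not_zero gen_idempotent by (simp add: pt_def val_gen)

lemma gens_in_pt: "T \<in> points \<Longrightarrow> {x \<in> S. gen x \<in> pt T} = T"
  using gen_in_pt by auto

section \<open>The Stone topology expressed through points\<close>

lemma stone_open_eq:
  assumes "e \<in> idempotents A"
  shows "stone_open (idem_bool_alg A) e = pt ` {T \<in> points. val T e = \<one>\<^bsub>R\<^esub>}"
proof (intro equalityI subsetI)
  fix \<xi> assume "\<xi> \<in> stone_open (idem_bool_alg A) e"
  then have \<xi>: "ultrafilter_on (idem_bool_alg A) \<xi>" "e \<in> \<xi>"
    by (auto simp: stone_open_def)
  define T where "T = {x \<in> S. gen x \<in> \<xi>}"
  have T: "T \<in> points" "\<xi> = pt T"
    using ultrafilter_eq_pt[OF \<xi>(1)] unfolding T_def by auto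
  then have "val T e = \<one>\<^bsub>R\<^esub>"
    using \<xi>(2) by (simp add: pt_def)
  then show "\<xi> \<in> pt ` {T \<in> points. val T e = \<one>\<^bsub>R\<^esub>}"
    using T by blast
next
  fix \<xi> assume "\<xi> \<in> pt ` {T \<in> points. val T e = \<one>\<^bsub>R\<^esub>}"
  then obtain T where "\<xi> = pt T" "T \<in> points" "val T e = \<one>\<^bsub>R\<^esub>"
    by blast
  then show "\<xi> \<in> stone_open (idem_bool_alg A) e"
    using ultrafilter_pt assms by (simp add: stone_open_def pt_def)
qed

lemma topspace_stone_dual: "topspace (stone_dual (idem_bool_alg A)) = pt ` points"
proof -
  let ?O = "\<lambda>e. pt ` {T \<in> points. val T e = \<one>\<^bsub>R\<^esub>}"
  have "topspace (stone_dual (idem_bool_alg A)) = (\<Union>e\<in>idempotents A. stone_open (idem_bool_alg A) e)"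
    unfolding stone_dual_def topology_generated_by_topspace bool_alg_simps Setcompr_eq_image ..
  also have "\<dots> = (\<Union>e\<in>idempotents A. ?O e)"
    by (rule SUP_cong[OF refl stone_open_eq])
  also have "\<dots> = pt ` points"
  proof (rule equalityI)
    show "(\<Union>e\<in>idempotents A. ?O e) \<subseteq> pt ` points"
      by (rule UN_least, rule image_mono) auto
    \<comment> \<open>The unit has value 1 at every point, so a single basic open set is already the
      whole space.\<close>
    have "pt ` points \<subseteq> ?O \<one>\<^bsub>A\<^esub>"
      by (rule image_mono) (simp add: val_one subset_iff)
    then show "pt ` points \<subseteq> (\<Union>e\<in>idempotents A. ?O e)"
      using UN_upper[OF one_idem, of ?O] by (rule order_trans)
  qed
  finally show ?thesis .
qed

text \<open>Apply \<open>T'\<close> to the equation \<open>a m = T(a) m\<close>, where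
  \<open>m\<close> is the minterm: \<open>T'\<close> sends \<open>m\<close> to 1. Both the local
  constancy of the representing functions and the continuity of the map onto the Stone dual rest on
  this.\<close>

lemma val_eq_near:
  assumes a: "a \<in> carrier A" "determined_by F a" and T: "T \<in> points" "T' \<in> points"
    and one: "val T' (minterm F T) = \<one>\<^bsub>R\<^esub>"
  shows "val T' a = val T a"
proof -
  have m: "minterm F T \<in> carrier A"
    using a minterm_closed by (simp add: determined_by_def)
  have "val T' (a \<otimes>\<^bsub>A\<^esub> minterm F T) = val T' (val T a \<odot>\<^bsub>A\<^esub> minterm F T)"
    using a T by (simp add: determined_by_def)
  then show ?thesis
    unfolding val_mult[OF T(2) a(1) m] val_smult[OF T(2) val_closed[OF T(1) a(1)] m] one
    using val_closed[OF T(1) a(1)] val_closed[OF T(2) a(1)] by simp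
qed

lemma stone_open_mult:
  assumes "e \<in> idempotents A" "f \<in> idempotents A"
  shows "stone_open (idem_bool_alg A) (e \<otimes>\<^bsub>A\<^esub> f) =
    stone_open (idem_bool_alg A) e \<inter> stone_open (idem_bool_alg A) f"
proof -
  have ef: "e \<otimes>\<^bsub>A\<^esub> f \<in> idempotents A"
    by (rule mult_idem[OF assms])
  have "(e \<otimes>\<^bsub>A\<^esub> f) \<otimes>\<^bsub>A\<^esub> e = (e \<otimes>\<^bsub>A\<^esub> e) \<otimes>\<^bsub>A\<^esub> f"
    "(e \<otimes>\<^bsub>A\<^esub> f) \<otimes>\<^bsub>A\<^esub> f = e \<otimes>\<^bsub>A\<^esub> (f \<otimes>\<^bsub>A\<^esub> f)"
    using assms[THEN idem_closed] by algebra+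
  then have eq: "(e \<otimes>\<^bsub>A\<^esub> f) \<otimes>\<^bsub>A\<^esub> e = e \<otimes>\<^bsub>A\<^esub> f"
    "(e \<otimes>\<^bsub>A\<^esub> f) \<otimes>\<^bsub>A\<^esub> f = e \<otimes>\<^bsub>A\<^esub> f"
    using assms by (auto simp: idempotents_def)
  have "e \<otimes>\<^bsub>A\<^esub> f \<in> \<xi> \<longleftrightarrow> e \<in> \<xi> \<and> f \<in> \<xi>" if "ultrafilter_on (idem_bool_alg A) \<xi>" for \<xi>
  proof -
    have p: "proper_filter (idem_bool_alg A) \<xi>"
      using that by (simp add: ultrafilter_on_def)
    then have "x \<in> \<xi>" if "e \<otimes>\<^bsub>A\<^esub> f \<in> \<xi>" "x \<in> idempotents A" "(e \<otimes>\<^bsub>A\<^esub> f) \<otimes>\<^bsub>A\<^esub> x = e \<otimes>\<^bsub>A\<^esub> f" for x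
      using that unfolding proper_filter_def bool_alg_simps by blast
    moreover have "e \<otimes>\<^bsub>A\<^esub> f \<in> \<xi>" if "e \<in> \<xi>" "f \<in> \<xi>"
      using that p unfolding proper_filter_def bool_alg_simps by blast
    ultimately show ?thesis
      using assms eq by blast
  qed
  then show ?thesis
    unfolding stone_open_def by blast
qed

lemma openin_stone_open:
  "e \<in> idempotents A \<Longrightarrow> openin (stone_dual (idem_bool_alg A)) (stone_open (idem_bool_alg A) e)"
  unfolding stone_dual_def bool_alg_simps by (rule topology_generated_by_Basis) blast

text \<open>By definition the sets \<open>stone_open\<close> only form a subbasis; they are a basis
  because meets of idempotents give intersections.\<close>

lemma stone_basis:
  assumes "openin (stone_dual (idem_bool_alg A)) U" "\<xi> \<in> U"
  shows "\<exists>e\<in>idempotents A. \<xi> \<in> stone_open (idem_bool_alg A) e \<and> stone_open (idem_bool_alg A) e \<subseteq> U"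
proof -
  have "generate_topology_on {stone_open (idem_bool_alg A) x |x. x \<in> idempotents A} U"
    using assms(1) unfolding stone_dual_def bool_alg_simps by (rule openin_topology_generated_by)
  then show ?thesis
    using assms(2)
  proof (induction rule: generate_topology_on.induct)
    case (Int a b)
    then obtain e f where "e \<in> idempotents A" "f \<in> idempotents A"
      "\<xi> \<in> stone_open (idem_bool_alg A) e" "stone_open (idem_bool_alg A) e \<subseteq> a"
      "\<xi> \<in> stone_open (idem_bool_alg A) f" "stone_open (idem_bool_alg A) f \<subseteq> b"
      by blast
    then show ?case
      by (intro bexI[of _ "e \<otimes>\<^bsub>A\<^esub> f"]) (auto simp: stone_open_mult mult_idem)
  qed blast+
qed

lemma compact_stone_dual: "compact_space (stone_dual (idem_bool_alg A))"
proof -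
  let ?X = "stone_dual (idem_bool_alg A)"
  let ?P = "product_topology (\<lambda>_. discrete_topology (UNIV :: bool set)) S"
  \<comment> \<open>Inserting \<open>u\<close> turns every boolean function into a point, so
    Tychonoff applies to the full product rather than to the subspace of functions true at
    \<open>u\<close>.\<close>
  define tr where "tr w = insert u {x \<in> S. w x}" for w :: "'s \<Rightarrow> bool"
  have tr: "tr w \<in> points" for w
    using u_in by (auto simp: tr_def)
  have top: "topspace ?P = S \<rightarrow>\<^sub>E UNIV"
    by simp
  have "continuous_map ?P ?X (pt \<circ> tr)"
    unfolding stone_dual_def continuous_on_generated_topo_iff
  proof (intro conjI allI impI)
    fix V assume "V \<in> {stone_open (idem_bool_alg A) x |x. x \<in> carrier (idem_bool_alg A)}"
    then obtain e where e: "e \<in> idempotents A" and V: "V = stone_open (idem_bool_alg A) e"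
      by auto
    obtain F where F: "determined_by F e"
      using finitely_determined[OF idem_closed[OF e]] by blast
    then have F': "finite F" "F \<subseteq> S"
      by (auto simp: determined_by_def)
    have mem: "(pt \<circ> tr) w \<in> V \<longleftrightarrow> val (tr w) e = \<one>\<^bsub>R\<^esub>" for w
      using ultrafilter_pt[OF tr] e by (simp add: V stone_open_def pt_def)
    show "openin ?P ((pt \<circ> tr) -` V \<inter> topspace ?P)"
    proof (subst openin_subopen, intro ballI)
      fix w assume w: "w \<in> (pt \<circ> tr) -` V \<inter> topspace ?P"
      \<comment> \<open>The cylinder of functions agreeing with \<open>w\<close> on
        \<open>F\<close>; it is open since only finitely many coordinates are constrained.\<close>
      define W where "W = (\<Pi>\<^sub>E x\<in>S. if x \<in> F then {w x} else UNIV)"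
      have "finite {x \<in> S. (if x \<in> F then {w x} else UNIV) \<noteq> (UNIV :: bool set)}"
        by (rule finite_subset[OF _ F'(1)]) auto
      then have "openin ?P W"
        unfolding W_def openin_PiE_gen by simp
      moreover have "w \<in> W"
        using w unfolding W_def top by auto
      moreover have "W \<subseteq> (pt \<circ> tr) -` V \<inter> topspace ?P"
      proof
        fix v assume v: "v \<in> W"
        then have vw: "v x = w x" if "x \<in> F" for x
          using that F'(2) PiE_mem[OF v[unfolded W_def], of x] by auto
        have "tr v \<inter> F = tr w \<inter> F"
          using vw by (auto simp: tr_def)
        \<comment> \<open>The minterm of \<open>tr w\<close> is also that of \<open>tr v\<close>,
          hence has value 1 at \<open>tr v\<close>, and \<open>val_eq_near\<close> applies.\<close>
        then have "minterm F (tr w) = minterm F (tr v)"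
          using F'(2) minterm_cong by metis
        then have "val (tr v) e = val (tr w) e"
          using val_eq_near[OF idem_closed[OF e] F tr tr] val_minterm[OF tr F'] by simp
        moreover have "v \<in> topspace ?P"
          using v unfolding W_def top by (auto simp: PiE_iff)
        ultimately show "v \<in> (pt \<circ> tr) -` V \<inter> topspace ?P"
          using w mem by simp
      qed
      ultimately show "\<exists>W. openin ?P W \<and> w \<in> W \<and> W \<subseteq> (pt \<circ> tr) -` V \<inter> topspace ?P"
        by blast
    qed
  next
    have "(pt \<circ> tr) ` topspace ?P \<subseteq> topspace ?X"
      unfolding topspace_stone_dual using tr by auto
    then show "(pt \<circ> tr) ` topspace ?P \<subseteq> \<Union> {stone_open (idem_bool_alg A) x |x. x \<in> carrier (idem_bool_alg A)}"
      unfolding stone_dual_def topology_generated_by_topspace .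
  qed
  moreover have "compactin ?P (topspace ?P)"
    using compact_space_product_topology[of "\<lambda>_. discrete_topology (UNIV :: bool set)" S]
    by (simp add: compact_space_def[symmetric] compact_space_discrete_topology del: topspace_product_topology)
  ultimately have "compactin ?X ((pt \<circ> tr) ` topspace ?P)"
    by (rule image_compactin[rotated])
  moreover have "(pt \<circ> tr) ` topspace ?P = topspace ?X"
  proof (intro equalityI subsetI)
    fix \<xi> assume "\<xi> \<in> topspace ?X"
    then obtain T where T: "T \<in> points" "\<xi> = pt T"
      unfolding topspace_stone_dual by blast
    have "tr (restrict (\<lambda>x. x \<in> T) S) = T"
      using T by (auto simp: tr_def)
    then show "\<xi> \<in> (pt \<circ> tr) ` topspace ?P"
      using T unfolding top by (intro image_eqI[of _ _ "restrict (\<lambda>x. x \<in> T) S"]) auto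
  qed (use tr topspace_stone_dual in auto)
  ultimately show ?thesis
    by (simp add: compact_space_def)
qed

section \<open>The representation by locally constant functions\<close>

abbreviation "X \<equiv> stone_dual (idem_bool_alg A)"

text \<open>The map sending \<open>\<xi>\<close> to \<open>{x \<in> S. gen x \<in> \<xi>}\<close> is
  the inverse of \<open>pt\<close>, so this is evaluation of \<open>a\<close> at the point behind
  \<open>\<xi>\<close>. The restriction follows the convention of \<open>Lc\<close> for values off
  the space.\<close>

definition stone_rep :: "'a \<Rightarrow> 'a set \<Rightarrow> 'r"
  where "stone_rep a = (\<lambda>\<xi>\<in>topspace X. val {x \<in> S. gen x \<in> \<xi>} a)"

lemma pt_in_topspace: "T \<in> points \<Longrightarrow> pt T \<in> topspace X"
  unfolding topspace_stone_dual by blast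

lemma stone_rep_pt:
  assumes "T \<in> points"
  shows "stone_rep a (pt T) = val T a"
  unfolding stone_rep_def restrict_apply'[OF pt_in_topspace[OF assms]] gens_in_pt[OF assms] ..

lemma topspaceE:
  assumes "\<xi> \<in> topspace X"
  obtains T where "T \<in> points" "\<xi> = pt T"
  using assms unfolding topspace_stone_dual by blast

lemma fun_on_topspace_eqI:
  assumes "f \<in> extensional (topspace X)" "g \<in> extensional (topspace X)"
    and "\<And>T. T \<in> points \<Longrightarrow> f (pt T) = g (pt T)"
  shows "f = g"
  using assms(1,2)
proof (rule extensionalityI)
  fix \<xi> assume "\<xi> \<in> topspace X"
  then show "f \<xi> = g \<xi>"
    using assms(3) by (elim topspaceE) simp
qed

lemma stone_rep_extensional: "stone_rep a \<in> extensional (topspace X)"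
  by (simp add: stone_rep_def)

lemma stone_rep_in_Lc:
  assumes a: "a \<in> carrier A"
  shows "stone_rep a \<in> carrier (Lc X R)"
proof -
  obtain F where F: "determined_by F a"
    using finitely_determined[OF a] by blast
  then have F': "finite F" "F \<subseteq> S"
    by (auto simp: determined_by_def)
  have "stone_rep a \<in> topspace X \<rightarrow>\<^sub>E carrier R"
  proof (rule PiE_I)
    fix \<xi> assume "\<xi> \<in> topspace X"
    then show "stone_rep a \<xi> \<in> carrier R"
      using val_closed a by (elim topspaceE) (simp add: stone_rep_pt)
  qed (simp add: stone_rep_def)
  moreover have "locally_constant_on X (stone_rep a)"
    unfolding locally_constant_on_def
  proof
    fix \<xi> assume "\<xi> \<in> topspace X"
    then obtain T where T: "T \<in> points" "\<xi> = pt T"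
      by (rule topspaceE)
    let ?U = "stone_open (idem_bool_alg A) (minterm F T)"
    have m: "minterm F T \<in> idempotents A"
      by (rule minterm_idem[OF F'])
    have U: "?U = pt ` {T' \<in> points. val T' (minterm F T) = \<one>\<^bsub>R\<^esub>}"
      by (rule stone_open_eq[OF m])
    have "\<xi> \<in> ?U"
      using T val_minterm[OF T(1) F'] unfolding U by blast
    moreover have "stone_rep a \<eta> = stone_rep a \<xi>" if \<eta>: "\<eta> \<in> ?U" for \<eta>
    proof -
      obtain T' where T': "\<eta> = pt T'" "T' \<in> points" "val T' (minterm F T) = \<one>\<^bsub>R\<^esub>"
        using \<eta> unfolding U by blast
      then show ?thesis
        using val_eq_near[OF a F T(1) T'(2,3)] T by (simp add: stone_rep_pt)
    qed
    ultimately show "\<exists>U. openin X U \<and> \<xi> \<in> U \<and> (\<forall>\<eta>\<in>U. stone_rep a \<eta> = stone_rep a \<xi>)"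
      using openin_stone_open[OF m] by blast
  qed
  \<comment> \<open>The support condition is automatic: a closed set in a compact space.\<close>
  moreover have "compactin X (X closure_of {\<xi> \<in> topspace X. stone_rep a \<xi> \<noteq> \<zero>\<^bsub>R\<^esub>})"
    by (rule closedin_compact_space[OF compact_stone_dual closedin_closure_of])
  ultimately show ?thesis
    by (simp add: Lc_def)
qed

lemma stone_rep_hom: "stone_rep \<in> algebra_hom R A (Lc X R)"
  unfolding algebra_hom_def
proof (intro CollectI conjI ballI ring_hom_memI)
  fix r a assume "r \<in> carrier R" "a \<in> carrier A"
  then show "stone_rep (r \<odot>\<^bsub>A\<^esub> a) = r \<odot>\<^bsub>Lc X R\<^esub> stone_rep a"
    by (auto intro!: fun_on_topspace_eqI stone_rep_extensional
        simp: stone_rep_pt val_smult Lc_def pt_in_topspace)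
next
  fix a b assume "a \<in> carrier A" "b \<in> carrier A"
  then show "stone_rep (a \<otimes>\<^bsub>A\<^esub> b) = stone_rep a \<otimes>\<^bsub>Lc X R\<^esub> stone_rep b"
    and "stone_rep (a \<oplus>\<^bsub>A\<^esub> b) = stone_rep a \<oplus>\<^bsub>Lc X R\<^esub> stone_rep b"
    by (auto intro!: fun_on_topspace_eqI stone_rep_extensional
        simp: stone_rep_pt val_mult val_add Lc_def pt_in_topspace)
next
  show "stone_rep \<one>\<^bsub>A\<^esub> = \<one>\<^bsub>Lc X R\<^esub>"
    by (auto intro!: fun_on_topspace_eqI stone_rep_extensional
        simp: stone_rep_pt val_one Lc_def pt_in_topspace)
qed (rule stone_rep_in_Lc)

lemma stone_rep_gen:
  assumes x: "x \<in> S"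
  shows "stone_rep (gen x) = char_fun X R (stone_open (idem_bool_alg A) (gen x))"
proof (rule fun_on_topspace_eqI)
  fix T assume T: "T \<in> points"
  have "pt T \<in> stone_open (idem_bool_alg A) (gen x) \<longleftrightarrow> x \<in> T"
    using ultrafilter_pt[OF T] gen_in_pt[OF T x] by (simp add: stone_open_def)
  then show "stone_rep (gen x) (pt T) = char_fun X R (stone_open (idem_bool_alg A) (gen x)) (pt T)"
    using T x pt_in_topspace[OF T] val_gen by (simp add: char_fun_def stone_rep_pt)
qed (simp_all add: stone_rep_def char_fun_def)

text \<open>Uniqueness of \<open>\<Psi>\<close>: the set where two homomorphisms agree is closed
  under all operations occurring in \<open>generated\<close>.\<close>

lemma algebra_hom_eqI:
  assumes \<Phi>: "\<Phi> \<in> algebra_hom R A C" and \<Psi>: "\<Psi> \<in> algebra_hom R A C"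
    and gen: "\<And>x. x \<in> S \<Longrightarrow> \<Phi> (gen x) = \<Psi> (gen x)" and a: "a \<in> carrier A"
  shows "\<Phi> a = \<Psi> a"
  using a
proof (rule generated)
  show "\<Phi> \<one>\<^bsub>A\<^esub> = \<Psi> \<one>\<^bsub>A\<^esub>"
    using \<Phi> \<Psi> by (simp add: algebra_hom_def ring_hom_def)
qed (use \<Phi> \<Psi> gen in \<open>simp_all add: algebra_hom_def ring_hom_def\<close>)

lemma stone_rep_inj: "inj_on stone_rep (carrier A)"
proof (rule inj_onI)
  fix a b assume ab: "a \<in> carrier A" "b \<in> carrier A" "stone_rep a = stone_rep b"
  show "a = b"
    using ab(1,2)
  proof (rule eq_if_val_eq)
    fix T assume "T \<in> points"
    then show "val T a = val T b"
      using ab(3) stone_rep_pt by metis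
  qed
qed

text \<open>Finitely many basic open sets on which \<open>f\<close> is constant cover the space. The
  preimage is assembled by overwriting values one idempotent after another, so the cover can keep
  its overlaps.\<close>

lemma stone_rep_surj:
  assumes f: "f \<in> carrier (Lc X R)"
  shows "\<exists>a\<in>carrier A. stone_rep a = f"
proof -
  have fX: "f \<in> topspace X \<rightarrow>\<^sub>E carrier R" and loc: "locally_constant_on X f"
    using f by (auto simp: Lc_def)
  have fc: "f (pt T) \<in> carrier R" if "T \<in> points" for T
    using PiE_mem[OF fX pt_in_topspace[OF that]] .
  \<comment> \<open>\<open>c\<close> is required to lie in \<open>R\<close> so that it can serve as
    a scalar below, even for an idempotent whose open set is empty.\<close>
  define const where "const e \<longleftrightarrow> e \<in> idempotents A \<and>
    (\<exists>c\<in>carrier R. \<forall>T\<in>points. val T e = \<one>\<^bsub>R\<^esub> \<longrightarrow> f (pt T) = c)" for e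
  have cover: "\<exists>e. const e \<and> \<xi> \<in> stone_open (idem_bool_alg A) e" if \<xi>: "\<xi> \<in> topspace X" for \<xi>
  proof -
    obtain U where U: "openin X U" "\<xi> \<in> U" "\<forall>\<eta>\<in>U. f \<eta> = f \<xi>"
      using loc \<xi> by (auto simp: locally_constant_on_def)
    obtain e where e: "e \<in> idempotents A" "\<xi> \<in> stone_open (idem_bool_alg A) e"
      "stone_open (idem_bool_alg A) e \<subseteq> U"
      using stone_basis[OF U(1,2)] by blast
    have "f (pt T) = f \<xi>" if "T \<in> points" "val T e = \<one>\<^bsub>R\<^esub>" for T
    proof -
      have "pt T \<in> stone_open (idem_bool_alg A) e"
        unfolding stone_open_eq[OF e(1)] using that by blast
      then show ?thesis
        using U(3) e(3) by blast
    qed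
    then have "const e"
      using e(1) PiE_mem[OF fX \<xi>] unfolding const_def by blast
    then show ?thesis
      using e(2) by blast
  qed
  have patch: "\<exists>a\<in>carrier A. \<forall>T\<in>points. (\<exists>e\<in>E. val T e = \<one>\<^bsub>R\<^esub>) \<longrightarrow> val T a = f (pt T)"
    if "finite E" "\<forall>e\<in>E. const e" for E
    using that
  proof (induction E rule: finite_induct)
    case empty
    show ?case
      \<comment> \<open>With no idempotents the condition is vacuous and any witness works.\<close>
      by (rule bexI[of _ "\<one>\<^bsub>A\<^esub>"]) auto
  next
    case (insert e E)
    then obtain a where a: "a \<in> carrier A"
      "\<And>T. \<lbrakk>T \<in> points; \<exists>e\<in>E. val T e = \<one>\<^bsub>R\<^esub>\<rbrakk> \<Longrightarrow> val T a = f (pt T)"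
      by auto
    have "const e"
      using insert.prems by simp
    then obtain c where c: "c \<in> carrier R" "\<And>T. \<lbrakk>T \<in> points; val T e = \<one>\<^bsub>R\<^esub>\<rbrakk> \<Longrightarrow> f (pt T) = c"
      and e: "e \<in> idempotents A"
      unfolding const_def by blast
    have ec: "e \<in> carrier A" "\<one>\<^bsub>A\<^esub> \<ominus>\<^bsub>A\<^esub> e \<in> carrier A"
      using idem_closed[OF e] by auto
    \<comment> \<open>Overwrites \<open>a\<close> by \<open>c\<close> where \<open>e\<close> has
      value 1 and leaves it alone where \<open>e\<close> has value 0. On overlaps both prescriptions
      are the value of \<open>f\<close>.\<close>
    define b where "b = a \<otimes>\<^bsub>A\<^esub> (\<one>\<^bsub>A\<^esub> \<ominus>\<^bsub>A\<^esub> e) \<oplus>\<^bsub>A\<^esub> c \<odot>\<^bsub>A\<^esub> e"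
    have b: "b \<in> carrier A"
      unfolding b_def using a(1) ec c(1) by blast
    have vb: "val T b = val T a \<otimes>\<^bsub>R\<^esub> (\<one>\<^bsub>R\<^esub> \<ominus>\<^bsub>R\<^esub> val T e) \<oplus>\<^bsub>R\<^esub> c \<otimes>\<^bsub>R\<^esub> val T e" if "T \<in> points" for T
      unfolding b_def val_add[OF that A.m_closed[OF a(1) ec(2)] smult_closed[OF c(1) ec(1)]]
        val_mult[OF that a(1) ec(2)] val_minus[OF that A.one_closed ec(1)] val_one[OF that]
        val_smult[OF that c(1) ec(1)] ..
    have "val T b = f (pt T)" if T: "T \<in> points" and E: "\<exists>d\<in>insert e E. val T d = \<one>\<^bsub>R\<^esub>" for T
    proof -
      have va: "val T a \<in> carrier R"
        by (rule val_closed[OF T a(1)])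
      consider "val T e = \<one>\<^bsub>R\<^esub>" | "val T e = \<zero>\<^bsub>R\<^esub>"
        using val_idem[OF T e] by blast
      then show ?thesis
      proof cases
        case 1
        then show ?thesis
          unfolding vb[OF T] c(2)[OF T 1] using va c(1) by (simp add: a_minus_def R.r_neg)
      next
        case 2
        then have "\<exists>d\<in>E. val T d = \<one>\<^bsub>R\<^esub>"
          using E one_not_zero by auto
        then have "val T a = f (pt T)"
          by (rule a(2)[OF T])
        then show ?thesis
          unfolding vb[OF T] 2 using va c(1) by (simp add: a_minus_def)
      qed
    qed
    then show ?case
      using b by blast
  qed
  let ?C = "stone_open (idem_bool_alg A) ` Collect const"
  have "\<And>U. U \<in> ?C \<Longrightarrow> openin X U"
    using openin_stone_open by (auto simp: const_def)
  moreover have "topspace X \<subseteq> \<Union>?C"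
    using cover by blast
  ultimately obtain D where D: "finite D" "D \<subseteq> ?C" "topspace X \<subseteq> \<Union>D"
    using compact_stone_dual unfolding compact_space_alt by meson
  obtain E where E: "finite E" "E \<subseteq> Collect const" "D = stone_open (idem_bool_alg A) ` E"
    using finite_subset_image[OF D(1,2)] by blast
  then obtain a where a: "a \<in> carrier A"
    "\<And>T. \<lbrakk>T \<in> points; \<exists>e\<in>E. val T e = \<one>\<^bsub>R\<^esub>\<rbrakk> \<Longrightarrow> val T a = f (pt T)"
    using patch[of E] by blast
  have "stone_rep a = f"
  proof (rule fun_on_topspace_eqI)
    fix T assume T: "T \<in> points"
    then obtain e where e: "e \<in> E" "pt T \<in> stone_open (idem_bool_alg A) e"
      using D(3) E(3) pt_in_topspace by blast
    then have "val T e = \<one>\<^bsub>R\<^esub>"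
      by (simp add: stone_open_def pt_def)
    then show "stone_rep a (pt T) = f (pt T)"
      using a(2)[OF T] e(1) T by (auto simp: stone_rep_pt)
  next
    show "f \<in> extensional (topspace X)"
      using fX by (simp add: PiE_def)
  qed (simp add: stone_rep_def)
  then show ?thesis
    using a(1) by blast
qed

theorem stone_rep_iso: "stone_rep \<in> algebra_iso R A (Lc X R)"
  using stone_rep_hom stone_rep_inj stone_rep_in_Lc stone_rep_surj
  by (auto simp: algebra_iso_def bij_betw_def)

end

section \<open>The free algebra\<close>

context cring
begin

definition conv :: "('s list \<Rightarrow> 'a) \<Rightarrow> ('s list \<Rightarrow> 'a) \<Rightarrow> 's list \<Rightarrow> 'a"
  where "conv f g w = (\<Oplus>k\<in>{..length w}. f (take k w) \<otimes> g (drop k w))"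

text \<open>Noncommutative formal power series. The laws of convolution are proved at this level,
  where no supports have to be tracked and left derivatives stay inside.\<close>

abbreviation series :: "('s list \<Rightarrow> 'a) set"
  where "series \<equiv> UNIV \<rightarrow> carrier R"

lemma seriesD: "f \<in> series \<Longrightarrow> f w \<in> carrier R"
  by auto

lemma conv_closed: "\<lbrakk>f \<in> series; g \<in> series\<rbrakk> \<Longrightarrow> conv f g w \<in> carrier R"
  unfolding conv_def by (rule finsum_closed) (auto dest: seriesD)

lemma conv_series: "\<lbrakk>f \<in> series; g \<in> series\<rbrakk> \<Longrightarrow> conv f g \<in> series"
  using conv_closed by blast

lemma conv_Nil: "\<lbrakk>f \<in> series; g \<in> series\<rbrakk> \<Longrightarrow> conv f g [] = f [] \<otimes> g []"
  using seriesD[of f "[]"] seriesD[of g "[]"] by (simp add: conv_def finsum_singleton finsum_0)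

text \<open>
  With \<^term>\<open>\<lambda>v. f (x # v)\<close> as the left derivative of \<open>f\<close> with respect to the letter \<open>x\<close>, this
  is a Leibniz rule; it turns the laws of convolution into inductions on words.
\<close>

lemma conv_Cons:
  assumes "f \<in> series" "g \<in> series"
  shows "conv f g (x # w) = f [] \<otimes> g (x # w) \<oplus> conv (\<lambda>v. f (x # v)) g w"
proof -
  have "conv f g (x # w) = (\<Oplus>k\<in>{..Suc (length w)}. f (take k (x # w)) \<otimes> g (drop k (x # w)))"
    by (simp add: conv_def)
  \<comment> \<open>The term \<open>k = 0\<close>, with empty prefix, is split off; in all others
    the prefix starts with \<open>x\<close>, which produces the derivative of
    \<open>f\<close>.\<close>
  also have "\<dots> = (\<Oplus>k\<in>{..length w}. f (take (Suc k) (x # w)) \<otimes> g (drop (Suc k) (x # w))) \<oplus>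
      f (take 0 (x # w)) \<otimes> g (drop 0 (x # w))"
    by (rule finsum_Suc2) (use assms in \<open>auto dest: seriesD\<close>)
  also have "(\<Oplus>k\<in>{..length w}. f (take (Suc k) (x # w)) \<otimes> g (drop (Suc k) (x # w))) = conv (\<lambda>v. f (x # v)) g w"
    by (simp add: conv_def)
  finally show ?thesis
    using a_comm[OF conv_closed[of "\<lambda>v. f (x # v)" g w]] assms seriesD[of f] seriesD[of g] by auto
qed

lemma conv_zero_left: "g \<in> series \<Longrightarrow> conv (\<lambda>v. \<zero>) g w = \<zero>"
  by (induction w) (auto simp: conv_Nil conv_Cons seriesD)

lemma conv_add_left:
  "\<lbrakk>f \<in> series; g \<in> series; h \<in> series\<rbrakk> \<Longrightarrow> conv (\<lambda>v. f v \<oplus> g v) h w = conv f h w \<oplus> conv g h w"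
proof (induction w arbitrary: f g)
  case Nil
  then show ?case
    using seriesD[of f] seriesD[of g] seriesD[of h] by (simp add: conv_Nil Pi_def l_distr)
next
  case (Cons x w)
  note c = seriesD[OF Cons.prems(1), of "[]"] seriesD[OF Cons.prems(2), of "[]"]
    seriesD[OF Cons.prems(3), of "x # w"]
  have d: "(\<lambda>v. f (x # v)) \<in> series" "(\<lambda>v. g (x # v)) \<in> series" "(\<lambda>v. f v \<oplus> g v) \<in> series"
    using Cons.prems by (auto dest: seriesD)
  have e: "conv (\<lambda>v. f (x # v)) h w \<in> carrier R" "conv (\<lambda>v. g (x # v)) h w \<in> carrier R"
    using d Cons.prems(3) conv_closed by blast+
  show ?case
    unfolding conv_Cons[OF Cons.prems(1,3)] conv_Cons[OF Cons.prems(2,3)] conv_Cons[OF d(3) Cons.prems(3)]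
      Cons.IH[OF d(1,2) Cons.prems(3)]
    using c e by (simp add: l_distr r_distr m_assoc a_ac)
qed

lemma conv_add_right:
  "\<lbrakk>f \<in> series; g \<in> series; h \<in> series\<rbrakk> \<Longrightarrow> conv f (\<lambda>v. g v \<oplus> h v) w = conv f g w \<oplus> conv f h w"
proof (induction w arbitrary: f)
  case Nil
  then show ?case
    using seriesD[of f] seriesD[of g] seriesD[of h] by (simp add: conv_Nil Pi_def r_distr)
next
  case (Cons x w)
  note c = seriesD[OF Cons.prems(1), of "[]"] seriesD[OF Cons.prems(2), of "x # w"]
    seriesD[OF Cons.prems(3), of "x # w"]
  have d: "(\<lambda>v. f (x # v)) \<in> series" "(\<lambda>v. g v \<oplus> h v) \<in> series"
    using Cons.prems by (auto dest: seriesD)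
  have e: "conv (\<lambda>v. f (x # v)) g w \<in> carrier R" "conv (\<lambda>v. f (x # v)) h w \<in> carrier R"
    using d Cons.prems conv_closed by blast+
  show ?case
    unfolding conv_Cons[OF Cons.prems(1,3)] conv_Cons[OF Cons.prems(1,2)] conv_Cons[OF Cons.prems(1) d(2)]
      Cons.IH[OF d(1) Cons.prems(2,3)]
    using c e by (simp add: l_distr r_distr m_assoc a_ac)
qed

lemma conv_smult_left:
  "\<lbrakk>r \<in> carrier R; f \<in> series; g \<in> series\<rbrakk> \<Longrightarrow> conv (\<lambda>v. r \<otimes> f v) g w = r \<otimes> conv f g w"
proof (induction w arbitrary: f)
  case Nil
  then show ?case
    using seriesD[of f] seriesD[of g] by (simp add: conv_Nil Pi_def m_assoc)
next
  case (Cons x w)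
  note c = Cons.prems(1) seriesD[OF Cons.prems(2), of "[]"] seriesD[OF Cons.prems(3), of "x # w"]
  have d: "(\<lambda>v. f (x # v)) \<in> series" "(\<lambda>v. r \<otimes> f v) \<in> series"
    using Cons.prems by (auto dest: seriesD)
  have e: "conv (\<lambda>v. f (x # v)) g w \<in> carrier R"
    using d Cons.prems conv_closed by blast+
  show ?case
    unfolding conv_Cons[OF Cons.prems(2,3)] conv_Cons[OF d(2) Cons.prems(3)]
      Cons.IH[OF Cons.prems(1) d(1) Cons.prems(3)]
    using c e by (simp add: l_distr r_distr m_assoc a_ac)
qed

text \<open>Commutativity of \<open>R\<close> enters: \<open>r\<close> has to pass the coefficients
  of the left factor.\<close>

lemma conv_smult_right:
  "\<lbrakk>r \<in> carrier R; f \<in> series; g \<in> series\<rbrakk> \<Longrightarrow> conv f (\<lambda>v. r \<otimes> g v) w = r \<otimes> conv f g w"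
proof (induction w arbitrary: f)
  case Nil
  then show ?case
    using seriesD[of f] seriesD[of g] by (simp add: conv_Nil Pi_def m_lcomm)
next
  case (Cons x w)
  note c = Cons.prems(1) seriesD[OF Cons.prems(2), of "[]"] seriesD[OF Cons.prems(3), of "x # w"]
  have d: "(\<lambda>v. f (x # v)) \<in> series" "(\<lambda>v. r \<otimes> g v) \<in> series"
    using Cons.prems by (auto dest: seriesD)
  have e: "conv (\<lambda>v. f (x # v)) g w \<in> carrier R"
    using d Cons.prems conv_closed by blast+
  show ?case
    unfolding conv_Cons[OF Cons.prems(2,3)] conv_Cons[OF Cons.prems(2) d(2)]
      Cons.IH[OF Cons.prems(1) d(1) Cons.prems(3)]
    using c e by (simp add: l_distr r_distr m_lcomm a_ac)
qed

text \<open>The derivative of \<open>conv f g\<close> is \<open>f []\<close> times the derivative of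
  \<open>g\<close> plus the product of the derivative of \<open>f\<close> with \<open>g\<close>.
  Linearity on the left splits it, and the induction hypothesis is used for the derivative of
  \<open>f\<close>, which is why \<open>f\<close> is generalised.\<close>

lemma conv_assoc:
  "\<lbrakk>f \<in> series; g \<in> series; h \<in> series\<rbrakk> \<Longrightarrow> conv (conv f g) h w = conv f (conv g h) w"
proof (induction w arbitrary: f)
  case Nil
  then show ?case
    using seriesD[of f "[]"] seriesD[of g "[]"] seriesD[of h "[]"]
    by (simp add: conv_Nil[OF conv_series] conv_Nil[OF _ conv_series] conv_Nil m_assoc)
next
  case (Cons x w)
  note s = Cons.prems
  note c = seriesD[OF s(1), of "[]"] seriesD[OF s(2), of "[]"] seriesD[OF s(3), of "x # w"]
  have d: "(\<lambda>v. f (x # v)) \<in> series" "(\<lambda>v. g (x # v)) \<in> series" "(\<lambda>v. f [] \<otimes> g (x # v)) \<in> series"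
    using s by (auto dest: seriesD)
  have e: "conv (\<lambda>v. g (x # v)) h w \<in> carrier R" "conv (\<lambda>v. f (x # v)) (conv g h) w \<in> carrier R"
    using d s by (auto intro!: conv_closed conv_series)
  have "conv (\<lambda>v. conv f g (x # v)) h w =
      conv (\<lambda>v. f [] \<otimes> g (x # v) \<oplus> conv (\<lambda>v. f (x # v)) g v) h w"
    unfolding conv_Cons[OF s(1,2)] ..
  also have "\<dots> = f [] \<otimes> conv (\<lambda>v. g (x # v)) h w \<oplus> conv (\<lambda>v. f (x # v)) (conv g h) w"
    unfolding conv_add_left[OF d(3) conv_series[OF d(1) s(2)] s(3)]
      conv_smult_left[OF c(1) d(2) s(3)] Cons.IH[OF d(1) s(2,3)] ..
  finally show ?case
    unfolding conv_Cons[OF conv_series[OF s(1,2)] s(3)] conv_Cons[OF s(1) conv_series[OF s(2,3)]]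
      conv_Nil[OF s(1,2)] conv_Cons[OF s(2,3)]
    using c e by (simp add: l_distr r_distr m_assoc a_ac)
qed

section \<open>Monomials, supports and the ring structure of the free algebra\<close>

definition monomial :: "'a \<Rightarrow> 's list \<Rightarrow> 's list \<Rightarrow> 'a"
  where "monomial r w = (\<lambda>v. if v = w then r else \<zero>)"

lemma monomial_series: "r \<in> carrier R \<Longrightarrow> monomial r w \<in> series"
  by (auto simp: monomial_def)

lemma conv_one_left:
  assumes f: "f \<in> series"
  shows "conv (monomial \<one> []) f w = f w"
proof (cases w)
  case Nil
  show ?thesis
    using seriesD[OF f] unfolding Nil conv_Nil[OF monomial_series[OF one_closed] f]
    by (simp add: monomial_def)
next
  case (Cons x v)
  have "(\<lambda>v. monomial \<one> [] (x # v)) = (\<lambda>v. \<zero>)"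
    by (simp add: monomial_def)
  then show ?thesis
    using seriesD[OF f] unfolding Cons conv_Cons[OF monomial_series[OF one_closed] f]
    by (simp add: conv_zero_left[OF f] monomial_def)
qed

lemma conv_one_right: "f \<in> series \<Longrightarrow> conv f (monomial \<one> []) w = f w"
proof (induction w arbitrary: f)
  case Nil
  then show ?case
    using seriesD[of f "[]"] unfolding conv_Nil[OF Nil monomial_series[OF one_closed]]
    by (simp add: monomial_def)
next
  case (Cons x w)
  have "(\<lambda>v. f (x # v)) \<in> series"
    using Cons.prems by auto
  then show ?case
    using Cons.IH seriesD[OF Cons.prems] unfolding conv_Cons[OF Cons.prems monomial_series[OF one_closed]]
    by (simp add: monomial_def)
qed

text \<open>The derivative of the letter \<open>x\<close> with respect to \<open>y\<close> is 1 if
  \<open>x = y\<close> and 0 otherwise, so left multiplication by a letter merely shifts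
  words.\<close>

lemma conv_gen_left:
  assumes f: "f \<in> series"
  shows "conv (monomial \<one> [x]) f w = (case w of [] \<Rightarrow> \<zero> | y # v \<Rightarrow> if x = y then f v else \<zero>)"
proof (cases w)
  case Nil
  show ?thesis
    using seriesD[OF f] unfolding Nil conv_Nil[OF monomial_series[OF one_closed] f]
    by (simp add: monomial_def)
next
  case (Cons y v)
  have "(\<lambda>v. monomial \<one> [x] (y # v)) = (if x = y then monomial \<one> [] else (\<lambda>v. \<zero>))"
    by (auto simp: monomial_def)
  moreover have "monomial \<one> [x] [] = \<zero>"
    by (simp add: monomial_def)
  ultimately show ?thesis
    using seriesD[OF f] unfolding Cons conv_Cons[OF monomial_series[OF one_closed] f]
    by (simp add: conv_zero_left[OF f] conv_one_left[OF f])
qed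

text \<open>A nonzero coefficient at \<open>w\<close> needs a splitting of \<open>w\<close> with
  both coefficients nonzero. Hence finite support on words over \<open>S\<close> passes to
  products.\<close>

lemma conv_support:
  assumes "f \<in> series" "g \<in> series"
  shows "{w. conv f g w \<noteq> \<zero>} \<subseteq> (\<lambda>(a, b). a @ b) ` ({w. f w \<noteq> \<zero>} \<times> {w. g w \<noteq> \<zero>})"
proof
  fix w assume w: "w \<in> {w. conv f g w \<noteq> \<zero>}"
  have "\<exists>k. f (take k w) \<noteq> \<zero> \<and> g (drop k w) \<noteq> \<zero>"
  proof (rule ccontr)
    assume "\<nexists>k. f (take k w) \<noteq> \<zero> \<and> g (drop k w) \<noteq> \<zero>"
    then have "f (take k w) \<otimes> g (drop k w) = \<zero>" for k
      using seriesD[OF assms(1), of "take k w"] seriesD[OF assms(2), of "drop k w"]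
      by (cases "f (take k w) = \<zero>") auto
    then have "conv f g w = \<zero>"
      by (simp add: conv_def)
    then show False
      using w by simp
  qed
  then obtain k where "f (take k w) \<noteq> \<zero>" "g (drop k w) \<noteq> \<zero>"
    by blast
  then show "w \<in> (\<lambda>(a, b). a @ b) ` ({w. f w \<noteq> \<zero>} \<times> {w. g w \<noteq> \<zero>})"
    by (intro image_eqI[of _ _ "(take k w, drop k w)"]) auto
qed

lemma free_algebra_simps:
  "mult (free_algebra R S) = conv"
  "one (free_algebra R S) = monomial \<one> []"
  "zero (free_algebra R S) = (\<lambda>w. \<zero>)"
  "add (free_algebra R S) = (\<lambda>f g w. f w \<oplus> g w)"
  "smult (free_algebra R S) = (\<lambda>r f w. r \<otimes> f w)"
  by (auto simp: free_algebra_def conv_def monomial_def fun_eq_iff)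

lemma free_algebra_carrier:
  "f \<in> carrier (free_algebra R S) \<longleftrightarrow>
    f \<in> series \<and> finite {w. f w \<noteq> \<zero>} \<and> {w. f w \<noteq> \<zero>} \<subseteq> lists S"
  by (auto simp: free_algebra_def)

lemma free_series: "f \<in> carrier (free_algebra R S) \<Longrightarrow> f \<in> series"
  by (simp add: free_algebra_carrier)

lemma monomial_closed:
  assumes "r \<in> carrier R" "w \<in> lists S"
  shows "monomial r w \<in> carrier (free_algebra R S)"
proof -
  have "{v. monomial r w v \<noteq> \<zero>} \<subseteq> {w}"
    by (auto simp: monomial_def)
  then show ?thesis
    using assms monomial_series finite_subset[of _ "{w}"] by (auto simp: free_algebra_carrier)
qed

lemma free_mult_closed:
  assumes f: "f \<in> carrier (free_algebra R S)" and g: "g \<in> carrier (free_algebra R S)"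
  shows "conv f g \<in> carrier (free_algebra R S)"
proof -
  let ?D = "{w. f w \<noteq> \<zero>} \<times> {w. g w \<noteq> \<zero>}"
  have s: "{w. conv f g w \<noteq> \<zero>} \<subseteq> (\<lambda>(a, b). a @ b) ` ?D"
    using conv_support f g free_series by blast
  have fin: "finite ((\<lambda>(a, b). a @ b) ` ?D)"
    using f g by (intro finite_imageI finite_cartesian_product) (simp_all add: free_algebra_carrier)
  have "?D \<subseteq> lists S \<times> lists S"
    using f g by (intro Sigma_mono) (simp_all add: free_algebra_carrier)
  then have "(\<lambda>(a, b). a @ b) ` ?D \<subseteq> (\<lambda>(a, b). a @ b) ` (lists S \<times> lists S)"
    by (rule image_mono)
  also have "\<dots> \<subseteq> lists S"
    by auto
  finally have "(\<lambda>(a, b). a @ b) ` ?D \<subseteq> lists S" .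
  then show ?thesis
    using conv_series[OF free_series[OF f] free_series[OF g]] finite_subset[OF s fin] order_trans[OF s]
    by (simp add: free_algebra_carrier)
qed

lemma free_carrierI:
  assumes "f \<in> series" "{w. f w \<noteq> \<zero>} \<subseteq> D" "finite D" "D \<subseteq> lists S"
  shows "f \<in> carrier (free_algebra R S)"
  using assms(1) finite_subset[OF assms(2,3)] order_trans[OF assms(2,4)]
  unfolding free_algebra_carrier by blast

lemma free_smult_closed:
  assumes r: "r \<in> carrier R" and f: "f \<in> carrier (free_algebra R S)"
  shows "(\<lambda>w. r \<otimes> f w) \<in> carrier (free_algebra R S)"
proof (rule free_carrierI)
  show "(\<lambda>w. r \<otimes> f w) \<in> series"
    using r free_series[OF f] by blast
  show "{w. r \<otimes> f w \<noteq> \<zero>} \<subseteq> {w. f w \<noteq> \<zero>}"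
    using r by auto
qed (use f in \<open>simp_all add: free_algebra_carrier\<close>)

lemma free_add_closed:
  assumes f: "f \<in> carrier (free_algebra R S)" and g: "g \<in> carrier (free_algebra R S)"
  shows "(\<lambda>w. f w \<oplus> g w) \<in> carrier (free_algebra R S)"
proof (rule free_carrierI)
  show "(\<lambda>w. f w \<oplus> g w) \<in> series"
    using free_series[OF f] free_series[OF g] by blast
  show "{w. f w \<oplus> g w \<noteq> \<zero>} \<subseteq> {w. f w \<noteq> \<zero>} \<union> {w. g w \<noteq> \<zero>}"
    by auto
qed (use f g in \<open>simp_all add: free_algebra_carrier\<close>)

lemma ring_free_algebra: "ring (free_algebra R S)"
proof (rule ringI)
  show "abelian_group (free_algebra R S)"
  proof (rule abelian_groupI)
    fix f assume f: "f \<in> carrier (free_algebra R S)"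
    note c = seriesD[OF free_series[OF f]]
    \<comment> \<open>The negative is taken as the multiple by -1, so its closure is that of scalar
      multiples.\<close>
    have "(\<lambda>w. \<ominus> \<one> \<otimes> f w) \<in> carrier (free_algebra R S)"
      by (rule free_smult_closed[OF _ f]) simp
    moreover have "(\<lambda>w. \<ominus> \<one> \<otimes> f w) \<oplus>\<^bsub>free_algebra R S\<^esub> f = \<zero>\<^bsub>free_algebra R S\<^esub>"
      using c by (simp add: free_algebra_simps fun_eq_iff l_minus l_neg)
    ultimately show "\<exists>g\<in>carrier (free_algebra R S). g \<oplus>\<^bsub>free_algebra R S\<^esub> f = \<zero>\<^bsub>free_algebra R S\<^esub>"
      by blast
    show "\<zero>\<^bsub>free_algebra R S\<^esub> \<oplus>\<^bsub>free_algebra R S\<^esub> f = f"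
      using c by (simp add: free_algebra_simps)
  next
    fix f g h
    assume "f \<in> carrier (free_algebra R S)" "g \<in> carrier (free_algebra R S)" "h \<in> carrier (free_algebra R S)"
    note c = this[THEN free_series, THEN seriesD]
    show "f \<oplus>\<^bsub>free_algebra R S\<^esub> g \<oplus>\<^bsub>free_algebra R S\<^esub> h =
        f \<oplus>\<^bsub>free_algebra R S\<^esub> (g \<oplus>\<^bsub>free_algebra R S\<^esub> h)"
      using c by (simp add: free_algebra_simps a_assoc)
  next
    fix f g assume "f \<in> carrier (free_algebra R S)" "g \<in> carrier (free_algebra R S)"
    note c = this[THEN free_series, THEN seriesD]
    show "f \<oplus>\<^bsub>free_algebra R S\<^esub> g = g \<oplus>\<^bsub>free_algebra R S\<^esub> f"
      using c by (simp add: free_algebra_simps a_comm)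
  next
    show "\<zero>\<^bsub>free_algebra R S\<^esub> \<in> carrier (free_algebra R S)"
      by (simp add: free_algebra_simps free_algebra_carrier)
  qed (simp add: free_algebra_simps free_add_closed)
  show "Group.monoid (free_algebra R S)"
  proof (rule monoidI)
    show "\<one>\<^bsub>free_algebra R S\<^esub> \<in> carrier (free_algebra R S)"
      by (simp add: free_algebra_simps monomial_closed)
  qed (auto simp: free_algebra_simps fun_eq_iff conv_assoc conv_one_left conv_one_right free_mult_closed
      dest!: free_series)
qed (auto simp: free_algebra_simps fun_eq_iff conv_add_left conv_add_right dest!: free_series)

lemma free_gen_eq: "free_gen R x = monomial \<one> [x]"
  by (simp add: free_gen_def monomial_def fun_eq_iff)

lemma free_gen_closed: "x \<in> S \<Longrightarrow> free_gen R x \<in> carrier (free_algebra R S)"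
  unfolding free_gen_eq by (rule monomial_closed) auto

lemma monomial_Cons: "monomial \<one> (x # w) = conv (free_gen R x) (monomial \<one> w)"
proof
  fix v :: "'c list"
  show "monomial \<one> (x # w) v = conv (free_gen R x) (monomial \<one> w) v"
    unfolding free_gen_eq conv_gen_left[OF monomial_series[OF one_closed]]
    by (simp add: monomial_def split: list.split)
qed

text \<open>Letters multiply to words, words scale to monomials, and induction on the support
  removes one monomial at a time.\<close>

lemma free_algebra_generated:
  assumes f: "f \<in> carrier (free_algebra R S)"
    and one: "P \<one>\<^bsub>free_algebra R S\<^esub>" and gen: "\<And>x. x \<in> S \<Longrightarrow> P (free_gen R x)"
    and smult: "\<And>r g. \<lbrakk>r \<in> carrier R; g \<in> carrier (free_algebra R S); P g\<rbrakk> \<Longrightarrow> P (r \<odot>\<^bsub>free_algebra R S\<^esub> g)"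
    and add: "\<And>g h. \<lbrakk>g \<in> carrier (free_algebra R S); h \<in> carrier (free_algebra R S); P g; P h\<rbrakk>
      \<Longrightarrow> P (g \<oplus>\<^bsub>free_algebra R S\<^esub> h)"
    and mult: "\<And>g h. \<lbrakk>g \<in> carrier (free_algebra R S); h \<in> carrier (free_algebra R S); P g; P h\<rbrakk>
      \<Longrightarrow> P (g \<otimes>\<^bsub>free_algebra R S\<^esub> h)"
  shows "P f"
proof -
  have word: "P (monomial \<one> w)" if "w \<in> lists S" for w
    using that
  proof (induction w)
    case Nil
    show ?case
      using one by (simp add: free_algebra_simps)
  next
    case (Cons x w)
    show ?case
      using mult[OF free_gen_closed monomial_closed, of x \<one> w] gen[of x] Cons
      by (simp add: monomial_Cons free_algebra_simps)
  qed
  have mono: "P (monomial r w)" if "r \<in> carrier R" "w \<in> lists S" for r w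
  proof -
    have "monomial r w = r \<odot>\<^bsub>free_algebra R S\<^esub> monomial \<one> w"
      using that(1) by (simp add: monomial_def free_algebra_simps fun_eq_iff)
    then show ?thesis
      using smult[OF that(1) monomial_closed[OF one_closed that(2)] word[OF that(2)]] by simp
  qed
  have "\<lbrakk>finite D; f \<in> carrier (free_algebra R S); {w. f w \<noteq> \<zero>} = D\<rbrakk> \<Longrightarrow> P f" for D f
  proof (induction D arbitrary: f rule: finite_induct)
    case empty
    \<comment> \<open>Zero is reached as the zero multiple of the empty word.\<close>
    then have "f = monomial \<zero> []"
      by (auto simp: monomial_def fun_eq_iff)
    then show ?case
      using mono[of \<zero> "[]"] by simp
  next
    case (insert w D)
    note f = insert.prems(1)
    have w: "w \<in> lists S"
      using f insert.prems(2) unfolding free_algebra_carrier by blast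
    let ?g = "f(w := \<zero>)"
    have s: "{v. ?g v \<noteq> \<zero>} = D"
      using insert.prems(2) insert.hyps(2) by auto
    have g: "?g \<in> carrier (free_algebra R S)"
    proof (rule free_carrierI)
      show "?g \<in> series"
        using free_series[OF f] by auto
      show "{v. ?g v \<noteq> \<zero>} \<subseteq> {v. f v \<noteq> \<zero>}"
        by auto
    qed (use f in \<open>simp_all add: free_algebra_carrier\<close>)
    have fw: "f v \<in> carrier R" for v
      using seriesD[OF free_series[OF f]] .
    have eq: "monomial (f w) w \<oplus>\<^bsub>free_algebra R S\<^esub> ?g = f"
      using fw by (auto simp: free_algebra_simps monomial_def fun_eq_iff)
    have "P (monomial (f w) w \<oplus>\<^bsub>free_algebra R S\<^esub> ?g)"
      by (rule add[OF monomial_closed[OF fw w] g mono[OF fw w] insert.IH[OF g s]])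
    then show ?case
      unfolding eq .
  qed
  then show ?thesis
    using f by (auto simp: free_algebra_carrier)
qed

text \<open>
  The character of the free algebra that sends the generators in \<open>T\<close> to one and the others to
  zero: a word is sent to one iff all its letters are in \<open>T\<close>.
\<close>

definition eval_at :: "'s set \<Rightarrow> ('s list \<Rightarrow> 'a) \<Rightarrow> 'a"
  where "eval_at T f = (\<Oplus>w\<in>{w \<in> lists T. f w \<noteq> \<zero>}. f w)"

text \<open>Frees the index set from the support of \<open>f\<close>, so that two elements and their
  sum can be summed over one common finite set.\<close>

lemma eval_at_eq:
  assumes "f \<in> series" "finite W" "W \<subseteq> lists T" "{w \<in> lists T. f w \<noteq> \<zero>} \<subseteq> W"
  shows "eval_at T f = (\<Oplus>w\<in>W. f w)"
  unfolding eval_at_def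
  by (rule add.finprod_mono_neutral_cong_left) (use assms in blast)+

lemma eval_at_closed: "f \<in> series \<Longrightarrow> eval_at T f \<in> carrier R"
  unfolding eval_at_def by (rule finsum_closed) auto

lemma free_finite: "f \<in> carrier (free_algebra R S) \<Longrightarrow> finite {w. f w \<noteq> \<zero>}"
  by (simp add: free_algebra_carrier)

lemma eval_at_add:
  assumes f: "f \<in> carrier (free_algebra R S)" and g: "g \<in> carrier (free_algebra R S)"
  shows "eval_at T (f \<oplus>\<^bsub>free_algebra R S\<^esub> g) = eval_at T f \<oplus> eval_at T g"
proof -
  define W where "W = lists T \<inter> ({w. f w \<noteq> \<zero>} \<union> {w. g w \<noteq> \<zero>})"
  have W: "finite W" "W \<subseteq> lists T"
    using free_finite[OF f] free_finite[OF g] by (auto simp: W_def)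
  have "{w \<in> lists T. f w \<oplus> g w \<noteq> \<zero>} \<subseteq> W" "{w \<in> lists T. f w \<noteq> \<zero>} \<subseteq> W" "{w \<in> lists T. g w \<noteq> \<zero>} \<subseteq> W"
    by (auto simp: W_def)
  moreover have "(\<lambda>w. f w \<oplus> g w) \<in> series"
    using free_series[OF f] free_series[OF g] by blast
  ultimately have "eval_at T (\<lambda>w. f w \<oplus> g w) = (\<Oplus>w\<in>W. f w \<oplus> g w)" "eval_at T f = (\<Oplus>w\<in>W. f w)"
    "eval_at T g = (\<Oplus>w\<in>W. g w)"
    using W f g by (auto intro!: eval_at_eq free_series simp del: in_lists_conv_set)
  moreover have "(\<Oplus>w\<in>W. f w \<oplus> g w) = (\<Oplus>w\<in>W. f w) \<oplus> (\<Oplus>w\<in>W. g w)"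
    by (rule finsum_addf) (use free_series[OF f] free_series[OF g] in blast)+
  ultimately show ?thesis
    by (simp add: free_algebra_simps)
qed

lemma eval_at_smult:
  assumes r: "r \<in> carrier R" and f: "f \<in> carrier (free_algebra R S)"
  shows "eval_at T (r \<odot>\<^bsub>free_algebra R S\<^esub> f) = r \<otimes> eval_at T f"
proof -
  define W where "W = lists T \<inter> {w. f w \<noteq> \<zero>}"
  have W: "finite W" "W \<subseteq> lists T"
    using free_finite[OF f] by (auto simp: W_def)
  have s: "(\<lambda>w. r \<otimes> f w) \<in> series"
    using r free_series[OF f] by blast
  have "eval_at T (\<lambda>w. r \<otimes> f w) = (\<Oplus>w\<in>W. r \<otimes> f w)"
    by (rule eval_at_eq[OF s W]) (use r in \<open>auto simp: W_def\<close>)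
  also have "\<dots> = r \<otimes> (\<Oplus>w\<in>W. f w)"
    by (rule finsum_rdistr[symmetric]) (use r W free_series[OF f] in auto)
  also have "(\<Oplus>w\<in>W. f w) = eval_at T f"
    by (rule eval_at_eq[symmetric, OF free_series[OF f] W]) (auto simp: W_def)
  finally show ?thesis
    by (simp add: free_algebra_simps)
qed

lemma eval_at_one: "eval_at T \<one>\<^bsub>free_algebra R S\<^esub> = \<one>"
proof -
  have "eval_at T (monomial \<one> []) = finsum R (monomial \<one> []) ({[]} \<inter> lists T)"
    by (rule eval_at_eq) (auto simp: monomial_def)
  then show ?thesis
    by (simp add: free_algebra_simps monomial_def finsum_singleton)
qed

text \<open>Left multiplication by \<open>x\<close> puts \<open>x\<close> in front of each word of
  the support. For \<open>x \<in> T\<close> this matches up the words over \<open>T\<close> in the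
  two supports; otherwise no word of the product is over \<open>T\<close>.\<close>

lemma eval_at_gen_mult:
  assumes f: "f \<in> carrier (free_algebra R S)"
  shows "eval_at T (free_gen R x \<otimes>\<^bsub>free_algebra R S\<^esub> f) = (if x \<in> T then \<one> else \<zero>) \<otimes> eval_at T f"
proof -
  define h where "h = conv (free_gen R x) f"
  have h_Nil: "h [] = \<zero>" and h_Cons: "h (y # v) = (if x = y then f v else \<zero>)" for y v
    unfolding h_def free_gen_eq by (simp_all add: conv_gen_left[OF free_series[OF f]])
  have hs: "h \<in> series"
    unfolding h_def free_gen_eq using f by (intro conv_series monomial_series free_series[of f S]) auto
  have "eval_at T h = (if x \<in> T then \<one> else \<zero>) \<otimes> eval_at T f"
  proof (cases "x \<in> T")
    case True
    let ?D = "{w \<in> lists T. f w \<noteq> \<zero>}"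
    have fin: "finite ?D"
      using free_finite[OF f] by (rule rev_finite_subset) auto
    have "eval_at T h = (\<Oplus>w\<in>(#) x ` ?D. h w)"
    proof (rule eval_at_eq[OF hs])
      show "{w \<in> lists T. h w \<noteq> \<zero>} \<subseteq> (#) x ` ?D"
      proof
        fix w assume "w \<in> {w \<in> lists T. h w \<noteq> \<zero>}"
        then show "w \<in> (#) x ` ?D"
          by (cases w) (auto simp: h_Nil h_Cons split: if_splits)
      qed
    qed (use fin True in auto)
    also have "\<dots> = (\<Oplus>w\<in>?D. h (x # w))"
      by (rule finsum_reindex) (use hs in auto)
    also have "\<dots> = eval_at T f"
      unfolding eval_at_def h_Cons by simp
    finally show ?thesis
      using True eval_at_closed[OF free_series[OF f]] by simp
  next
    case False
    have "{w \<in> lists T. h w \<noteq> \<zero>} = {}"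
    proof -
      have "h w = \<zero>" if "w \<in> lists T" for w
        using that False by (cases w) (auto simp: h_Nil h_Cons)
      then show ?thesis
        by blast
    qed
    then have "eval_at T h = \<zero>"
      by (simp only: eval_at_def finsum_empty)
    then show ?thesis
      using False eval_at_closed[OF free_series[OF f]] by simp
  qed
  then show ?thesis
    by (simp add: h_def free_algebra_simps)
qed

lemma eval_at_gen:
  assumes "x \<in> S"
  shows "eval_at T (free_gen R x) = (if x \<in> T then \<one> else \<zero>)"
proof -
  interpret F: ring "free_algebra R S"
    by (rule ring_free_algebra)
  show ?thesis
    using eval_at_gen_mult[OF F.one_closed, of T x] free_gen_closed[OF assms] by (simp add: eval_at_one)
qed

lemma free_smult_mult:
  assumes "r \<in> carrier R" "f \<in> carrier (free_algebra R S)" "g \<in> carrier (free_algebra R S)"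
  shows "(r \<odot>\<^bsub>free_algebra R S\<^esub> f) \<otimes>\<^bsub>free_algebra R S\<^esub> g =
    r \<odot>\<^bsub>free_algebra R S\<^esub> (f \<otimes>\<^bsub>free_algebra R S\<^esub> g)"
  unfolding free_algebra_simps fun_eq_iff
  using conv_smult_left[OF assms(1) free_series[OF assms(2)] free_series[OF assms(3)]] by blast

lemma free_smult_in:
  "\<lbrakk>r \<in> carrier R; f \<in> carrier (free_algebra R S)\<rbrakk> \<Longrightarrow> r \<odot>\<^bsub>free_algebra R S\<^esub> f \<in> carrier (free_algebra R S)"
  using free_smult_closed by (simp add: free_algebra_simps)

text \<open>Induction on the generation of the left factor, with \<open>eval_at_gen_mult\<close> as
  the case of a letter; this avoids sums over pairs of words.\<close>

lemma eval_at_mult: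
  assumes f: "f \<in> carrier (free_algebra R S)" and g: "g \<in> carrier (free_algebra R S)"
  shows "eval_at T (f \<otimes>\<^bsub>free_algebra R S\<^esub> g) = eval_at T f \<otimes> eval_at T g"
proof -
  interpret F: ring "free_algebra R S"
    by (rule ring_free_algebra)
  note closed = eval_at_closed[OF free_series[of _ S]]
  \<comment> \<open>The right factor is quantified because the product case uses the claim for
    \<open>f\<close> at \<open>h \<otimes> g\<close>.\<close>
  have "\<forall>g\<in>carrier (free_algebra R S). eval_at T (f \<otimes>\<^bsub>free_algebra R S\<^esub> g) = eval_at T f \<otimes> eval_at T g"
    using f
  proof (rule free_algebra_generated)
    show "\<forall>g\<in>carrier (free_algebra R S). eval_at T (\<one>\<^bsub>free_algebra R S\<^esub> \<otimes>\<^bsub>free_algebra R S\<^esub> g) =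
        eval_at T \<one>\<^bsub>free_algebra R S\<^esub> \<otimes> eval_at T g"
      using closed by (simp add: eval_at_one)
  next
    fix x assume "x \<in> S"
    then show "\<forall>g\<in>carrier (free_algebra R S). eval_at T (free_gen R x \<otimes>\<^bsub>free_algebra R S\<^esub> g) =
        eval_at T (free_gen R x) \<otimes> eval_at T g"
      by (simp add: eval_at_gen_mult eval_at_gen)
  next
    fix r f assume "r \<in> carrier R" "f \<in> carrier (free_algebra R S)"
      and "\<forall>g\<in>carrier (free_algebra R S). eval_at T (f \<otimes>\<^bsub>free_algebra R S\<^esub> g) = eval_at T f \<otimes> eval_at T g"
    then show "\<forall>g\<in>carrier (free_algebra R S).
        eval_at T ((r \<odot>\<^bsub>free_algebra R S\<^esub> f) \<otimes>\<^bsub>free_algebra R S\<^esub> g) =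
        eval_at T (r \<odot>\<^bsub>free_algebra R S\<^esub> f) \<otimes> eval_at T g"
      using closed by (simp add: free_smult_mult eval_at_smult[where S = S] m_assoc)
  next
    fix f h assume "f \<in> carrier (free_algebra R S)" "h \<in> carrier (free_algebra R S)"
      and "\<forall>g\<in>carrier (free_algebra R S). eval_at T (f \<otimes>\<^bsub>free_algebra R S\<^esub> g) = eval_at T f \<otimes> eval_at T g"
      and "\<forall>g\<in>carrier (free_algebra R S). eval_at T (h \<otimes>\<^bsub>free_algebra R S\<^esub> g) = eval_at T h \<otimes> eval_at T g"
    then show "\<forall>g\<in>carrier (free_algebra R S). eval_at T ((f \<oplus>\<^bsub>free_algebra R S\<^esub> h) \<otimes>\<^bsub>free_algebra R S\<^esub> g) =
        eval_at T (f \<oplus>\<^bsub>free_algebra R S\<^esub> h) \<otimes> eval_at T g"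
      and "\<forall>g\<in>carrier (free_algebra R S). eval_at T ((f \<otimes>\<^bsub>free_algebra R S\<^esub> h) \<otimes>\<^bsub>free_algebra R S\<^esub> g) =
        eval_at T (f \<otimes>\<^bsub>free_algebra R S\<^esub> h) \<otimes> eval_at T g"
      using closed by (simp_all add: F.l_distr eval_at_add[where S = S] l_distr F.m_assoc m_assoc)
  qed
  then show ?thesis
    using g by blast
qed

lemma eval_at_ring_hom: "eval_at T \<in> ring_hom (free_algebra R S) R"
  by (rule ring_hom_memI) (simp_all add: eval_at_mult eval_at_add eval_at_one eval_at_closed free_series[of _ S])

end

section \<open>The universal algebra of commuting idempotents\<close>

locale idem_presentation = cring R for R :: "('r, 'm) ring_scheme" (structure) +
  fixes S :: "'s set" and u :: 's
  assumes u_in: "u \<in> S"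
begin

abbreviation "F \<equiv> free_algebra R S"
abbreviation "I \<equiv> idem_ideal R S u"
abbreviation "A \<equiv> idem_algebra R S u"

definition proj :: "('s list \<Rightarrow> 'r) \<Rightarrow> ('s list \<Rightarrow> 'r) set"
  where "proj f = I +>\<^bsub>F\<^esub> f"

sublocale F: ring F
  by (rule ring_free_algebra)

lemma relations_closed: "idem_relations R S u \<subseteq> carrier F"
  using u_in by (auto simp: idem_relations_def Let_def intro!: F.minus_closed F.m_closed free_gen_closed)

sublocale I: ideal I F
  unfolding idem_ideal_def by (rule F.genideal_ideal[OF relations_closed])

lemma relation_in_ideal: "f \<in> idem_relations R S u \<Longrightarrow> f \<in> I"
  unfolding idem_ideal_def using F.genideal_self[OF relations_closed] by blast

lemma idem_algebra_simps:
  "carrier A = carrier (F Quot I)"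
  "mult A = mult (F Quot I)"
  "one A = one (F Quot I)"
  "zero A = zero (F Quot I)"
  "add A = add (F Quot I)"
  "smult A = (\<lambda>r X. \<Union>f\<in>X. proj (r \<odot>\<^bsub>F\<^esub> f))"
  by (simp_all add: idem_algebra_def quotient_algebra_def ring.defs module.defs proj_def)

lemma carrier_idem_algebra: "carrier A = proj ` carrier F"
  unfolding idem_algebra_simps by (auto simp: FactRing_simps proj_def)

lemma proj_ring_hom: "proj \<in> ring_hom F A"
  using I.rcos_ring_hom unfolding ring_hom_def idem_algebra_simps proj_def[abs_def] by simp

lemma proj_closed: "f \<in> carrier F \<Longrightarrow> proj f \<in> carrier A"
  by (rule ring_hom_closed[OF proj_ring_hom])

lemma proj_mult:
  "\<lbrakk>f \<in> carrier F; g \<in> carrier F\<rbrakk> \<Longrightarrow> proj (f \<otimes>\<^bsub>F\<^esub> g) = proj f \<otimes>\<^bsub>A\<^esub> proj g"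
  by (rule ring_hom_mult[OF proj_ring_hom])

lemma proj_add:
  "\<lbrakk>f \<in> carrier F; g \<in> carrier F\<rbrakk> \<Longrightarrow> proj (f \<oplus>\<^bsub>F\<^esub> g) = proj f \<oplus>\<^bsub>A\<^esub> proj g"
  by (rule ring_hom_add[OF proj_ring_hom])

lemma proj_one: "proj \<one>\<^bsub>F\<^esub> = \<one>\<^bsub>A\<^esub>"
  by (rule ring_hom_one[OF proj_ring_hom])

lemma proj_eqI:
  assumes "f \<in> carrier F" "g \<in> carrier F" "f \<ominus>\<^bsub>F\<^esub> g \<in> I"
  shows "proj f = proj g"
  unfolding proj_def using F.quotient_eq_iff_same_a_r_cos[OF I.ideal_axioms assms(1,2)] assms(3) by simp

lemma mem_projE:
  assumes "g \<in> proj f"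
  obtains i where "i \<in> I" "g = i \<oplus>\<^bsub>F\<^esub> f"
  using assms unfolding proj_def a_r_coset_def' by blast

lemma free_smult_add:
  "\<lbrakk>r \<in> carrier R; f \<in> carrier F; g \<in> carrier F\<rbrakk> \<Longrightarrow>
    r \<odot>\<^bsub>F\<^esub> (f \<oplus>\<^bsub>F\<^esub> g) = r \<odot>\<^bsub>F\<^esub> f \<oplus>\<^bsub>F\<^esub> r \<odot>\<^bsub>F\<^esub> g"
  using seriesD[OF free_series[of f S]] seriesD[OF free_series[of g S]]
  by (simp add: free_algebra_simps r_distr)

text \<open>Scalar multiplication in the quotient is a union over all representatives of a coset; it
  is a single coset because scaling preserves the ideal.\<close>

lemma proj_smult:
  assumes r: "r \<in> carrier R" and f: "f \<in> carrier F"
  shows "r \<odot>\<^bsub>A\<^esub> proj f = proj (r \<odot>\<^bsub>F\<^esub> f)"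
proof -
  have "proj (r \<odot>\<^bsub>F\<^esub> g) = proj (r \<odot>\<^bsub>F\<^esub> f)" if g: "g \<in> proj f" for g
  proof -
    obtain i where i: "i \<in> I" "g = i \<oplus>\<^bsub>F\<^esub> f"
      using g by (rule mem_projE)
    have ic: "i \<in> carrier F"
      using i(1) by (rule I.a_Hcarr)
    have c: "r \<odot>\<^bsub>F\<^esub> i \<in> carrier F" "r \<odot>\<^bsub>F\<^esub> f \<in> carrier F" "r \<odot>\<^bsub>F\<^esub> \<one>\<^bsub>F\<^esub> \<in> carrier F"
      using r ic f by (auto intro: free_smult_in)
    \<comment> \<open>The ideal absorbs ring elements, not scalars, so \<open>r\<close> is replaced
      by the ring element \<open>r\<close> times 1.\<close>
    have "r \<odot>\<^bsub>F\<^esub> i = (r \<odot>\<^bsub>F\<^esub> \<one>\<^bsub>F\<^esub>) \<otimes>\<^bsub>F\<^esub> i"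
      using free_smult_mult[OF r F.one_closed ic] ic by simp
    then have "r \<odot>\<^bsub>F\<^esub> i \<in> I"
      using I.I_l_closed[OF i(1) c(3)] by simp
    moreover have "r \<odot>\<^bsub>F\<^esub> g \<ominus>\<^bsub>F\<^esub> r \<odot>\<^bsub>F\<^esub> f = r \<odot>\<^bsub>F\<^esub> i"
      unfolding i(2) free_smult_add[OF r ic f] using c(1,2) by (simp add: a_minus_def F.a_assoc F.r_neg)
    ultimately show ?thesis
      using c i(2) free_smult_add[OF r ic f] by (intro proj_eqI) auto
  qed
  \<comment> \<open>The union is over a nonempty set, so it equals the common value of its
    members.\<close>
  moreover have "f \<in> proj f"
    unfolding proj_def by (rule I.a_rcos_self[OF f])
  ultimately show ?thesis
    unfolding idem_algebra_simps by blast
qed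

lemma idem_algebra_generated:
  assumes "a \<in> carrier A" "P \<one>\<^bsub>A\<^esub>" "\<And>x. x \<in> S \<Longrightarrow> P (idem_gen R S u x)"
    and "\<And>r b. \<lbrakk>r \<in> carrier R; b \<in> carrier A; P b\<rbrakk> \<Longrightarrow> P (r \<odot>\<^bsub>A\<^esub> b)"
    and "\<And>b c. \<lbrakk>b \<in> carrier A; c \<in> carrier A; P b; P c\<rbrakk> \<Longrightarrow> P (b \<oplus>\<^bsub>A\<^esub> c)"
    and "\<And>b c. \<lbrakk>b \<in> carrier A; c \<in> carrier A; P b; P c\<rbrakk> \<Longrightarrow> P (b \<otimes>\<^bsub>A\<^esub> c)"
  shows "P a"
proof -
  obtain f where f: "f \<in> carrier F" "a = proj f"
    using assms(1) unfolding carrier_idem_algebra by blast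
  have "P (proj f)"
    using f(1)
  proof (rule free_algebra_generated)
    fix x assume "x \<in> S"
    then show "P (proj (free_gen R x))"
      using assms(3) by (simp add: idem_gen_def proj_def)
  next
    fix r g assume "r \<in> carrier R" "g \<in> carrier F" "P (proj g)"
    then show "P (proj (r \<odot>\<^bsub>F\<^esub> g))"
      using assms(4) proj_closed by (simp add: proj_smult[symmetric])
  qed (simp_all add: proj_one proj_add proj_mult proj_closed assms(2,5,6))
  then show ?thesis
    using f(2) by simp
qed

section \<open>The defining relations and the algebra axioms in the quotient\<close>

lemma idem_gen_proj: "idem_gen R S u x = proj (free_gen R x)"
  by (simp add: idem_gen_def proj_def)

lemma idem_gen_closed: "x \<in> S \<Longrightarrow> idem_gen R S u x \<in> carrier A"
  unfolding idem_gen_proj by (intro proj_closed free_gen_closed)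

lemma idem_gen_idem:
  assumes "x \<in> S"
  shows "idem_gen R S u x \<otimes>\<^bsub>A\<^esub> idem_gen R S u x = idem_gen R S u x"
proof -
  note g = free_gen_closed[OF assms]
  have "free_gen R x \<otimes>\<^bsub>F\<^esub> free_gen R x \<ominus>\<^bsub>F\<^esub> free_gen R x \<in> I"
    by (rule relation_in_ideal) (use assms in \<open>auto simp: idem_relations_def Let_def\<close>)
  then show ?thesis
    unfolding idem_gen_proj proj_mult[OF g g, symmetric] by (intro proj_eqI F.m_closed g)
qed

lemma idem_gen_comm:
  assumes "x \<in> S" "y \<in> S"
  shows "idem_gen R S u x \<otimes>\<^bsub>A\<^esub> idem_gen R S u y = idem_gen R S u y \<otimes>\<^bsub>A\<^esub> idem_gen R S u x"
proof -
  note g = assms[THEN free_gen_closed]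
  have "free_gen R x \<otimes>\<^bsub>F\<^esub> free_gen R y \<ominus>\<^bsub>F\<^esub> free_gen R y \<otimes>\<^bsub>F\<^esub> free_gen R x \<in> I"
    by (rule relation_in_ideal) (use assms in \<open>auto simp: idem_relations_def Let_def\<close>)
  then show ?thesis
    unfolding idem_gen_proj proj_mult[OF g, symmetric] proj_mult[OF g(2,1), symmetric]
    by (intro proj_eqI F.m_closed g)
qed

lemma idem_gen_unit: "idem_gen R S u u = \<one>\<^bsub>A\<^esub>"
proof -
  have "free_gen R u \<ominus>\<^bsub>F\<^esub> \<one>\<^bsub>F\<^esub> \<in> I"
    by (rule relation_in_ideal) (auto simp: idem_relations_def Let_def)
  then show ?thesis
    unfolding idem_gen_proj proj_one[symmetric] using u_in by (intro proj_eqI free_gen_closed F.one_closed)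
qed

text \<open>\<open>A\<close> is the image of \<open>F\<close> under \<open>proj\<close>. The fact on
  images of homomorphisms speaks of a record with carrier and zero replaced by images, and here both
  replacements change nothing.\<close>

lemma ring_idem_algebra: "ring A"
proof -
  have "proj \<zero>\<^bsub>F\<^esub> = \<zero>\<^bsub>A\<^esub>"
    unfolding idem_algebra_simps proj_def by (simp add: FactRing_def I.a_rcos_const[OF I.zero_closed])
  then have "A\<lparr>carrier := proj ` carrier F, zero := proj \<zero>\<^bsub>F\<^esub>\<rparr> = A"
    by (simp add: carrier_idem_algebra[symmetric])
  then show ?thesis
    using F.ring_hom_imp_img_ring[OF proj_ring_hom] by simp
qed

sublocale Q: ring A
  by (rule ring_idem_algebra)

lemma smult_idem_algebra:
  assumes r: "r \<in> carrier R" and a: "a \<in> carrier A" "b \<in> carrier A"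
  shows "r \<odot>\<^bsub>A\<^esub> a \<in> carrier A"
    and "s \<in> carrier R \<Longrightarrow> (r \<oplus> s) \<odot>\<^bsub>A\<^esub> a = r \<odot>\<^bsub>A\<^esub> a \<oplus>\<^bsub>A\<^esub> s \<odot>\<^bsub>A\<^esub> a"
    and "r \<odot>\<^bsub>A\<^esub> (a \<oplus>\<^bsub>A\<^esub> b) = r \<odot>\<^bsub>A\<^esub> a \<oplus>\<^bsub>A\<^esub> r \<odot>\<^bsub>A\<^esub> b"
    and "s \<in> carrier R \<Longrightarrow> (r \<otimes> s) \<odot>\<^bsub>A\<^esub> a = r \<odot>\<^bsub>A\<^esub> (s \<odot>\<^bsub>A\<^esub> a)"
    and "\<one> \<odot>\<^bsub>A\<^esub> a = a"
    and "(r \<odot>\<^bsub>A\<^esub> a) \<otimes>\<^bsub>A\<^esub> b = r \<odot>\<^bsub>A\<^esub> (a \<otimes>\<^bsub>A\<^esub> b)"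
    and "a \<otimes>\<^bsub>A\<^esub> (r \<odot>\<^bsub>A\<^esub> b) = r \<odot>\<^bsub>A\<^esub> (a \<otimes>\<^bsub>A\<^esub> b)"
proof -
  obtain f g where f: "f \<in> carrier F" "a = proj f" and g: "g \<in> carrier F" "b = proj g"
    using a unfolding carrier_idem_algebra by blast
  note c = seriesD[OF free_series[OF f(1)]] seriesD[OF free_series[OF g(1)]]
  note s = free_smult_in[OF _ f(1)] free_smult_in[OF _ g(1)]
  show "r \<odot>\<^bsub>A\<^esub> a \<in> carrier A"
    using r f s by (simp add: proj_smult proj_closed)
  show "(r \<oplus> s) \<odot>\<^bsub>A\<^esub> a = r \<odot>\<^bsub>A\<^esub> a \<oplus>\<^bsub>A\<^esub> s \<odot>\<^bsub>A\<^esub> a" if "s \<in> carrier R"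
  proof -
    have "(r \<oplus> s) \<odot>\<^bsub>F\<^esub> f = r \<odot>\<^bsub>F\<^esub> f \<oplus>\<^bsub>F\<^esub> s \<odot>\<^bsub>F\<^esub> f"
      using r that c by (simp add: free_algebra_simps l_distr)
    then show ?thesis
      using r that f s by (simp add: proj_smult proj_add)
  qed
  show "r \<odot>\<^bsub>A\<^esub> (a \<oplus>\<^bsub>A\<^esub> b) = r \<odot>\<^bsub>A\<^esub> a \<oplus>\<^bsub>A\<^esub> r \<odot>\<^bsub>A\<^esub> b"
    using r f g s free_smult_add[OF r f(1) g(1)] by (simp add: proj_smult proj_add[symmetric])
  show "(r \<otimes> s) \<odot>\<^bsub>A\<^esub> a = r \<odot>\<^bsub>A\<^esub> (s \<odot>\<^bsub>A\<^esub> a)" if "s \<in> carrier R"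
  proof -
    have "(r \<otimes> s) \<odot>\<^bsub>F\<^esub> f = r \<odot>\<^bsub>F\<^esub> (s \<odot>\<^bsub>F\<^esub> f)"
      using r that c by (simp add: free_algebra_simps m_assoc)
    then show ?thesis
      using r that f s by (simp add: proj_smult)
  qed
  have "\<one> \<odot>\<^bsub>F\<^esub> f = f"
    using c by (simp add: free_algebra_simps)
  then show "\<one> \<odot>\<^bsub>A\<^esub> a = a"
    using f by (simp add: proj_smult)
  show "(r \<odot>\<^bsub>A\<^esub> a) \<otimes>\<^bsub>A\<^esub> b = r \<odot>\<^bsub>A\<^esub> (a \<otimes>\<^bsub>A\<^esub> b)"
    using r f g s free_smult_mult[OF r f(1) g(1)] by (simp add: proj_smult proj_mult[symmetric])
  have "f \<otimes>\<^bsub>F\<^esub> (r \<odot>\<^bsub>F\<^esub> g) = r \<odot>\<^bsub>F\<^esub> (f \<otimes>\<^bsub>F\<^esub> g)"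
    unfolding free_algebra_simps fun_eq_iff
    using conv_smult_right[OF r free_series[OF f(1)] free_series[OF g(1)]] by blast
  then show "a \<otimes>\<^bsub>A\<^esub> (r \<odot>\<^bsub>A\<^esub> b) = r \<odot>\<^bsub>A\<^esub> (a \<otimes>\<^bsub>A\<^esub> b)"
    using r f g s by (simp add: proj_smult proj_mult[symmetric])
qed

text \<open>The elements commuting with \<open>a\<close> form a subalgebra, so it is enough to test
  generators.\<close>

lemma comm_if_comm_gens:
  assumes a: "a \<in> carrier A" and b: "b \<in> carrier A"
    and gens: "\<And>x. x \<in> S \<Longrightarrow> a \<otimes>\<^bsub>A\<^esub> idem_gen R S u x = idem_gen R S u x \<otimes>\<^bsub>A\<^esub> a"
  shows "a \<otimes>\<^bsub>A\<^esub> b = b \<otimes>\<^bsub>A\<^esub> a"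
  using b
proof (rule idem_algebra_generated)
  fix b c assume bc: "b \<in> carrier A" "c \<in> carrier A" "a \<otimes>\<^bsub>A\<^esub> b = b \<otimes>\<^bsub>A\<^esub> a" "a \<otimes>\<^bsub>A\<^esub> c = c \<otimes>\<^bsub>A\<^esub> a"
  show "a \<otimes>\<^bsub>A\<^esub> (b \<oplus>\<^bsub>A\<^esub> c) = (b \<oplus>\<^bsub>A\<^esub> c) \<otimes>\<^bsub>A\<^esub> a"
    using a bc by (simp add: Q.l_distr Q.r_distr)
  have "a \<otimes>\<^bsub>A\<^esub> (b \<otimes>\<^bsub>A\<^esub> c) = b \<otimes>\<^bsub>A\<^esub> (a \<otimes>\<^bsub>A\<^esub> c)"
    using a bc(1-3) by (simp add: Q.m_assoc[symmetric])
  then show "a \<otimes>\<^bsub>A\<^esub> (b \<otimes>\<^bsub>A\<^esub> c) = (b \<otimes>\<^bsub>A\<^esub> c) \<otimes>\<^bsub>A\<^esub> a"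
    using a bc by (simp add: Q.m_assoc)
qed (use a gens in \<open>simp_all add: smult_idem_algebra(6,7)\<close>)

text \<open>The relations only make generators commute with each other.
  \<open>comm_if_comm_gens\<close> is used twice: a generator commutes with everything, hence
  everything commutes with all generators and so with everything.\<close>

lemma cring_idem_algebra: "cring A"
proof -
  have "a \<otimes>\<^bsub>A\<^esub> b = b \<otimes>\<^bsub>A\<^esub> a" if "a \<in> carrier A" "b \<in> carrier A" for a b
    using that
  proof (rule comm_if_comm_gens)
    fix x assume x: "x \<in> S"
    have "idem_gen R S u x \<otimes>\<^bsub>A\<^esub> a = a \<otimes>\<^bsub>A\<^esub> idem_gen R S u x"
      by (rule comm_if_comm_gens[OF idem_gen_closed[OF x] that(1)]) (rule idem_gen_comm[OF x])
    then show "a \<otimes>\<^bsub>A\<^esub> idem_gen R S u x = idem_gen R S u x \<otimes>\<^bsub>A\<^esub> a"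
      by simp
  qed
  then show ?thesis
    by (intro cring.intro Q.ring_axioms comm_monoid.intro Q.monoid_axioms comm_monoid_axioms.intro)
qed

lemma algebra_idem_algebra: "algebra R A"
  by (rule algebraI[OF is_cring cring_idem_algebra])
    (simp_all add: smult_idem_algebra smult_idem_algebra(5)[OF one_closed _ Q.one_closed])

section \<open>Characters of the quotient, induced from the free algebra\<close>

definition eval_coset :: "'s set \<Rightarrow> ('s list \<Rightarrow> 'r) set \<Rightarrow> 'r"
  where "eval_coset T X = eval_at T (SOME f. f \<in> X)"

text \<open>A kernel is an ideal, so it need only contain the relations: 0 and 1 are idempotent,
  values in \<open>R\<close> commute, and \<open>u \<in> T\<close> makes \<open>u\<close> evaluate
  to 1.\<close>

lemma eval_at_ideal:
  assumes T: "T \<subseteq> S" "u \<in> T" and f: "f \<in> I"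
  shows "eval_at T f = \<zero>"
proof -
  interpret h: ring_hom_ring F R "eval_at T"
    by (rule ring_hom_ringI2[OF F.ring_axioms ring_axioms eval_at_ring_hom])
  have g: "eval_at T (free_gen R x) = (if x \<in> T then \<one> else \<zero>)" "free_gen R x \<in> carrier F" if "x \<in> S" for x
    by (rule eval_at_gen[OF that], rule free_gen_closed[OF that])
  have minus: "eval_at T (f \<ominus>\<^bsub>F\<^esub> g) = \<zero>"
    if "f \<in> carrier F" "g \<in> carrier F" "eval_at T f = eval_at T g" for f g
    using that h.hom_closed[OF that(2)] by (simp add: a_minus_def r_neg)
  have "idem_relations R S u \<subseteq> a_kernel F R (eval_at T)"
  proof
    fix r assume r: "r \<in> idem_relations R S u"
    then consider x where "x \<in> S" "r = free_gen R x \<otimes>\<^bsub>F\<^esub> free_gen R x \<ominus>\<^bsub>F\<^esub> free_gen R x"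
      | x y where "x \<in> S" "y \<in> S"
        "r = free_gen R x \<otimes>\<^bsub>F\<^esub> free_gen R y \<ominus>\<^bsub>F\<^esub> free_gen R y \<otimes>\<^bsub>F\<^esub> free_gen R x"
      | "r = free_gen R u \<ominus>\<^bsub>F\<^esub> \<one>\<^bsub>F\<^esub>"
      unfolding idem_relations_def Let_def by blast
    then have "eval_at T r = \<zero>"
    proof cases
      case 1
      show ?thesis
        unfolding 1(2) by (rule minus) (use g[OF 1(1)] in simp_all)
    next
      case 2
      show ?thesis
        unfolding 2(3) by (rule minus) (use g[OF 2(1)] g[OF 2(2)] in simp_all)
    next
      case 3
      show ?thesis
        unfolding 3 by (rule minus) (use g[OF u_in] T(2) eval_at_one in simp_all)
    qed
    then show "r \<in> a_kernel F R (eval_at T)"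
      unfolding a_kernel_def' by (intro CollectI conjI subsetD[OF relations_closed r])
  qed
  then have "I \<subseteq> a_kernel F R (eval_at T)"
    unfolding idem_ideal_def by (rule F.genideal_minimal[OF h.kernel_is_ideal])
  then show ?thesis
    using subsetD[of I _ f] f unfolding a_kernel_def' by blast
qed

text \<open>The choice of representative is harmless: two representatives differ by an element of
  the ideal, which \<open>eval_at T\<close> kills.\<close>

lemma eval_coset_proj:
  assumes T: "T \<subseteq> S" "u \<in> T" and f: "f \<in> carrier F"
  shows "eval_coset T (proj f) = eval_at T f"
proof -
  have "f \<in> proj f"
    unfolding proj_def by (rule I.a_rcos_self[OF f])
  then have "(SOME g. g \<in> proj f) \<in> proj f"
    by (rule someI[where P = "\<lambda>g. g \<in> proj f"])
  then obtain i where i: "i \<in> I" "(SOME g. g \<in> proj f) = i \<oplus>\<^bsub>F\<^esub> f"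
    by (rule mem_projE)
  then show ?thesis
    using eval_at_add[OF I.a_Hcarr[OF i(1)] f, of T] eval_at_ideal[OF T i(1)]
      eval_at_closed[OF free_series[OF f], of T]
    by (simp add: eval_coset_def)
qed

lemma eval_coset_hom:
  assumes T: "T \<subseteq> S" "u \<in> T"
  shows "eval_coset T \<in> algebra_hom R A (self_algebra R)"
  unfolding algebra_hom_def
proof (intro CollectI conjI ballI ring_hom_memI)
  fix a assume "a \<in> carrier A"
  then obtain f where f: "f \<in> carrier F" "a = proj f"
    unfolding carrier_idem_algebra by blast
  then show "eval_coset T a \<in> carrier (self_algebra R)"
    using eval_at_closed[OF free_series] T by (simp add: eval_coset_proj)
  fix r assume "r \<in> carrier R"
  then show "eval_coset T (r \<odot>\<^bsub>A\<^esub> a) = r \<odot>\<^bsub>self_algebra R\<^esub> eval_coset T a"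
    using f T by (simp add: proj_smult eval_coset_proj free_smult_in eval_at_smult)
next
  fix a b assume "a \<in> carrier A" "b \<in> carrier A"
  then obtain f g where "f \<in> carrier F" "a = proj f" "g \<in> carrier F" "b = proj g"
    unfolding carrier_idem_algebra by blast
  then show "eval_coset T (a \<otimes>\<^bsub>A\<^esub> b) = eval_coset T a \<otimes>\<^bsub>self_algebra R\<^esub> eval_coset T b"
    and "eval_coset T (a \<oplus>\<^bsub>A\<^esub> b) = eval_coset T a \<oplus>\<^bsub>self_algebra R\<^esub> eval_coset T b"
    using T by (simp_all add: proj_mult[symmetric] proj_add[symmetric] eval_coset_proj eval_at_mult eval_at_add)
next
  show "eval_coset T \<one>\<^bsub>A\<^esub> = \<one>\<^bsub>self_algebra R\<^esub>"
    using T by (simp add: proj_one[symmetric] eval_coset_proj eval_at_one)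
qed

lemma idem_generated_algebra_idem_algebra:
  assumes "\<one> \<noteq> \<zero>" "indecomposable R"
  shows "idem_generated_algebra R A S u (idem_gen R S u) eval_coset"
proof (intro idem_generated_algebra.intro idem_generated_algebra_axioms.intro)
  show "cring A"
    by (rule cring_idem_algebra)
  show "algebra R A"
    by (rule algebra_idem_algebra)
  show "eval_coset T (idem_gen R S u x) = (if x \<in> T then \<one> else \<zero>)"
    if "T \<subseteq> S" "u \<in> T" "x \<in> S" for T x
    using that by (simp add: idem_gen_proj eval_coset_proj free_gen_closed eval_at_gen)
  show "P a" if "a \<in> carrier A" "P \<one>\<^bsub>A\<^esub>" "\<And>x. x \<in> S \<Longrightarrow> P (idem_gen R S u x)"
    "\<And>r b. \<lbrakk>r \<in> carrier R; b \<in> carrier A; P b\<rbrakk> \<Longrightarrow> P (r \<odot>\<^bsub>A\<^esub> b)"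
    "\<And>b c. \<lbrakk>b \<in> carrier A; c \<in> carrier A; P b; P c\<rbrakk> \<Longrightarrow> P (b \<oplus>\<^bsub>A\<^esub> c)"
    "\<And>b c. \<lbrakk>b \<in> carrier A; c \<in> carrier A; P b; P c\<rbrakk> \<Longrightarrow> P (b \<otimes>\<^bsub>A\<^esub> c)" for a P
    using that by (rule idem_algebra_generated)
qed (fact assms is_cring u_in idem_gen_closed idem_gen_idem idem_gen_unit eval_coset_hom)+

end

theorem proposition3p1:
  fixes R :: "('r, 'm) ring_scheme" and S :: "'s set" and u :: 's
  assumes "cring R" and "\<one>\<^bsub>R\<^esub> \<noteq> \<zero>\<^bsub>R\<^esub>" and "indecomposable R"
    and "u \<in> S"
  defines "A \<equiv> idem_algebra R S u"
  defines "B \<equiv> idem_bool_alg A"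
  defines "X \<equiv> stone_dual B"
  defines "on_gens \<equiv> \<lambda>\<Phi>. \<forall>x\<in>S. \<Phi> (idem_gen R S u x) =
    char_fun X R (stone_open B (idem_gen R S u x))"
  shows "carrier A \<noteq> {\<zero>\<^bsub>A\<^esub>} \<and>
    (\<exists>\<Psi> \<in> algebra_hom R A (Lc X R). on_gens \<Psi> \<and>
      (\<forall>\<Phi> \<in> algebra_hom R A (Lc X R). on_gens \<Phi> \<longrightarrow> (\<forall>a\<in>carrier A. \<Phi> a = \<Psi> a)) \<and>
      \<Psi> \<in> algebra_iso R A (Lc X R))"
proof -
  interpret idem_presentation R S u
    using assms(1,4) by (simp add: idem_presentation_def idem_presentation_axioms_def)
  interpret G: idem_generated_algebra R A S u "idem_gen R S u" eval_coset
    unfolding A_def by (rule idem_generated_algebra_idem_algebra[OF assms(2,3)])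
  \<comment> \<open>\<open>S\<close> itself is a point; its character sends 1 and 0 of
    \<open>A\<close> to the distinct elements 1 and 0 of \<open>R\<close>.\<close>
  have "\<one>\<^bsub>A\<^esub> \<noteq> \<zero>\<^bsub>A\<^esub>"
    using G.val_one[of S] G.val_zero[of S] assms(2,4) by auto
  then have "carrier A \<noteq> {\<zero>\<^bsub>A\<^esub>}"
    using G.A.one_closed by blast
  moreover have "on_gens G.stone_rep"
    unfolding on_gens_def X_def B_def using G.stone_rep_gen by blast
  \<comment> \<open>Equality is claimed on the carrier, since \<open>algebra_hom\<close> leaves a
    function unconstrained elsewhere.\<close>
  moreover have "\<Phi> a = G.stone_rep a"
    if "\<Phi> \<in> algebra_hom R A (Lc X R)" "on_gens \<Phi>" "a \<in> carrier A" for \<Phi> a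
    using that(1) G.stone_rep_hom[folded B_def, folded X_def] _ that(3)
  proof (rule G.algebra_hom_eqI)
    fix x assume "x \<in> S"
    then show "\<Phi> (idem_gen R S u x) = G.stone_rep (idem_gen R S u x)"
      using that(2) \<open>on_gens G.stone_rep\<close> by (simp add: on_gens_def)
  qed
  ultimately show ?thesis
    using G.stone_rep_hom G.stone_rep_iso unfolding X_def B_def by blast
qed

end
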